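(* Let $A$ be a complex unital primitive Banach algebra whose socle $J=\mathrm{soc}(A)$ is not $\{0\}$, and let $p$ be a minimal idempotent of $A$. Assume that $\mathfrak{L}_r(A)$ is Drazin inverse closed in $L(Ap)$ and that $\mathfrak{L}_r(\mathrm{soc}(A))=F_0(Ap)$, where $\mathfrak{L}_r:A\to L(Ap)$ is the left regular representation of $A$ on $Ap$ and $F_0(Ap)$ is the ideal of finite rank operators in $L(Ap)$. Then an element $a\in A$ is a B-Weyl element if and only if $a=b+c$, where $b$ is a Drazin invertible element of $A$ and $c$ is an element of the socle $J$ of $A$.
   Context: An algebra is primitive if $\{0\}$ is a primitive ideal of it. $A$ denotes a complex unital primitive Banach algebra with unit $e$ and nonzero socle $J=\mathrm{soc}(A)$; $\pi:A\to A/J$ is the canonical projection. A minimal idempotent of $A$ is a nonzero idempotent $p$ with $pAp=\mathbb{C}p$; such idempotents exist. For a minimal idempotent $p$, $L(Ap)$ is the Banach algebra of bounded linear operators on the Banach space $Ap$. For $x\in A$, $\widehat{x}:Ap\to Ap$ is the operator $\widehat{x}(y)=xy$, and $\mathfrak{L}_r:A\to L(Ap)$ is defined by $\mathfrak{L}_r(x)=\widehat{x}$. An element $x$ of a unital ring $R$ is Drazin invertible in $R$ if there exist $y\in R$ (a Drazin inverse of $x$) and $k\in\mathbb{N}$ such that $yxy=y$, $xy=yx$ and $x^k y x=x^k$. The subalgebra $\mathfrak{L}_r(A)$ is Drazin inverse closed in $L(Ap)$ if every element of $\mathfrak{L}_r(A)$ that is Drazin invertible in $L(Ap)$ is Drazin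 invertible in $\mathfrak{L}_r(A)$. An element $a\in A$ is a B-Fredholm element of $A$ if $\pi(a)$ is Drazin invertible in $A/J$ (i.e. modulo the socle). An element $a_0\in A$ is a Drazin inverse of $a$ modulo $J$ if $\pi(a_0)$ is a Drazin inverse of $\pi(a)$ in $A/J$. The trace on the socle is $\tau(x)=\sum_{\lambda\in\sigma(x)} m(\lambda,x)\,\lambda$ for $x\in\mathrm{soc}(A)$, where $\sigma(x)$ is the spectrum of $x$ and $m(\lambda,x)$ is the algebraic multiplicity of $\lambda$ for $x$; for $\lambda\neq 0$ this is the rank of the Riesz (spectral) idempotent of $x$ at $\lambda$, where the rank of $u\in A$ is $\sup_{z\in A}\#(\sigma(zu)\setminus\{0\})$ (the value $\lambda=0$ contributes nothing). The index of a B-Fredholm element $a\in A$ is $\mathbf{i}(a)=\tau(aa_0-a_0a)$, where $a_0$ is a Drazin inverse of $a$ modulo $J$; it is well defined, independently of the choice of $a_0$. An element $a\in A$ is a B-Weyl element if it is a B-Fredholm element of index $0$. *)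

theory Defs
  imports "HOL-Analysis.Analysis" "HOL-Algebra.Algebraic_Closure_Type"
begin

section \<open>Complex unital Banach algebras\<close>

text \<open>Submultiplicativity of the norm comes from \<^class>\<open>real_normed_algebra\<close>; the unit is not
  required to have norm 1.\<close>

class complex_banach_algebra_1 = real_normed_algebra + ring_1 + banach +
  fixes scaleC :: "complex \<Rightarrow> 'a \<Rightarrow> 'a"  (infixr \<open>*\<^sub>C\<close> 75)
  assumes scaleC_add_right: "c *\<^sub>C (x + y) = c *\<^sub>C x + c *\<^sub>C y"
    and scaleC_add_left: "(c + d) *\<^sub>C x = c *\<^sub>C x + d *\<^sub>C x"
    and scaleC_scaleC: "c *\<^sub>C d *\<^sub>C x = (c * d) *\<^sub>C x"
    and scaleC_one: "1 *\<^sub>C x = x"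
    and scaleC_of_real: "complex_of_real r *\<^sub>C x = r *\<^sub>R x"
    and mult_scaleC_left: "c *\<^sub>C x * y = c *\<^sub>C (x * y)"
    and mult_scaleC_right: "x * c *\<^sub>C y = c *\<^sub>C (x * y)"
    and norm_scaleC: "norm (c *\<^sub>C x) = cmod c * norm x"

global_interpretation complex_vector:
  vector_space "scaleC :: complex \<Rightarrow> 'a \<Rightarrow> 'a::complex_banach_algebra_1"
  by unfold_locales
    (simp_all add: scaleC_add_right scaleC_add_left scaleC_scaleC scaleC_one)


section \<open>Ideals and the socle\<close>

definition left_ideal :: "'a::complex_banach_algebra_1 set \<Rightarrow> bool"
  where "left_ideal L \<longleftrightarrow> complex_vector.subspace L \<and> (\<forall>x. \<forall>y\<in>L. x * y \<in> L)"

definition maximal_left_ideal :: "'a::complex_banach_algebra_1 set \<Rightarrow> bool"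
  where "maximal_left_ideal L \<longleftrightarrow> left_ideal L \<and> L \<noteq> UNIV \<and>
    (\<forall>M. left_ideal M \<and> L \<subseteq> M \<longrightarrow> M = L \<or> M = UNIV)"

definition minimal_left_ideal :: "'a::complex_banach_algebra_1 set \<Rightarrow> bool"
  where "minimal_left_ideal L \<longleftrightarrow> left_ideal L \<and> L \<noteq> {0} \<and>
    (\<forall>M. left_ideal M \<and> M \<subseteq> L \<longrightarrow> M = {0} \<or> M = L)"

text \<open>A primitive ideal is the quotient \<open>L : A\<close> of a maximal modular left ideal \<open>L\<close>; in a unital
  algebra every left ideal is modular.\<close>

definition primitive_ideal :: "'a::complex_banach_algebra_1 set \<Rightarrow> bool"
  where "primitive_ideal P \<longleftrightarrow> (\<exists>L. maximal_left_ideal L \<and> P = {a. \<forall>x. a * x \<in> L})"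

text \<open>The sum of all minimal left ideals, which is \<open>{0}\<close> if there are none. In a semiprime algebra,
  in particular in a primitive one, it coincides with the sum of all minimal right ideals.\<close>

definition soc :: "'a::complex_banach_algebra_1 set"
  where "soc = complex_vector.span (\<Union>{L. minimal_left_ideal L})"

definition minimal_idempotent :: "'a::complex_banach_algebra_1 \<Rightarrow> bool"
  where "minimal_idempotent p \<longleftrightarrow> p \<noteq> 0 \<and> p * p = p \<and>
    range (\<lambda>x. p * x * p) = range (\<lambda>c. c *\<^sub>C p)"

definition quotient_map :: "'a::complex_banach_algebra_1 \<Rightarrow> 'a set"
  where "quotient_map a = soc +>\<^bsub>ring_of_type_algebra\<^esub> a"

abbreviation quotient_algebra :: "'a::complex_banach_algebra_1 set ring"
  where "quotient_algebra \<equiv> ring_of_type_algebra Quot soc"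


section \<open>Drazin inverses\<close>

definition drazin_inverse :: "('r, 'm) ring_scheme \<Rightarrow> 'r \<Rightarrow> 'r \<Rightarrow> bool"
  where "drazin_inverse R x y \<longleftrightarrow> x \<in> carrier R \<and> y \<in> carrier R \<and>
    y \<otimes>\<^bsub>R\<^esub> x \<otimes>\<^bsub>R\<^esub> y = y \<and> x \<otimes>\<^bsub>R\<^esub> y = y \<otimes>\<^bsub>R\<^esub> x \<and>
    (\<exists>k::nat. x [^]\<^bsub>R\<^esub> k \<otimes>\<^bsub>R\<^esub> y \<otimes>\<^bsub>R\<^esub> x = x [^]\<^bsub>R\<^esub> k)"

definition drazin_invertible :: "('r, 'm) ring_scheme \<Rightarrow> 'r \<Rightarrow> bool"
  where "drazin_invertible R x \<longleftrightarrow> (\<exists>y. drazin_inverse R x y)"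

definition drazin_inverse_closed :: "'r set \<Rightarrow> ('r, 'm) ring_scheme \<Rightarrow> bool"
  where "drazin_inverse_closed S R \<longleftrightarrow>
    (\<forall>x\<in>S. drazin_invertible R x \<longrightarrow> drazin_invertible (R\<lparr>carrier := S\<rparr>) x)"


section \<open>Operators on a subspace and the left regular representation\<close>

text \<open>Operators on \<open>V\<close> are represented by functions that are \<^const>\<open>undefined\<close> outside \<open>V\<close>, so
  that equality of functions is equality of operators.\<close>

definition bounded_operators :: "'a::complex_banach_algebra_1 set \<Rightarrow> ('a \<Rightarrow> 'a) ring"
  where "bounded_operators V = \<lparr>
    carrier = {T \<in> V \<rightarrow>\<^sub>E V.
      (\<forall>u\<in>V. \<forall>v\<in>V. T (u + v) = T u + T v) \<and>
      (\<forall>c. \<forall>u\<in>V. T (c *\<^sub>C u) = c *\<^sub>C T u) \<and>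
      (\<exists>K. \<forall>u\<in>V. norm (T u) \<le> K * norm u)},
    monoid.mult = compose V,
    one = (\<lambda>u\<in>V. u),
    ring.zero = (\<lambda>u\<in>V. 0),
    add = (\<lambda>S T. \<lambda>u\<in>V. S u + T u)\<rparr>"

definition finite_rank_operators :: "'a::complex_banach_algebra_1 set \<Rightarrow> ('a \<Rightarrow> 'a) set"
  where "finite_rank_operators V = {T \<in> carrier (bounded_operators V).
    \<exists>B. finite B \<and> T ` V \<subseteq> complex_vector.span B}"

definition principal_left_ideal :: "'a::complex_banach_algebra_1 \<Rightarrow> 'a set"
  where "principal_left_ideal p = range (\<lambda>x. x * p)"

definition left_regular_rep :: "'a::complex_banach_algebra_1 \<Rightarrow> 'a \<Rightarrow> ('a \<Rightarrow> 'a)"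
  where "left_regular_rep p x = (\<lambda>y\<in>principal_left_ideal p. x * y)"


section \<open>Spectrum, rank and trace\<close>

definition is_inverse :: "'a::complex_banach_algebra_1 \<Rightarrow> 'a \<Rightarrow> bool"
  where "is_inverse x y \<longleftrightarrow> x * y = 1 \<and> y * x = 1"

definition spectrum :: "'a::complex_banach_algebra_1 \<Rightarrow> complex set"
  where "spectrum x = {\<mu>. \<not> (\<exists>y. is_inverse (\<mu> *\<^sub>C 1 - x) y)}"

definition resolvent :: "'a::complex_banach_algebra_1 \<Rightarrow> complex \<Rightarrow> 'a"
  where "resolvent x \<mu> = (THE y. is_inverse (\<mu> *\<^sub>C 1 - x) y)"

definition elem_rank :: "'a::complex_banach_algebra_1 \<Rightarrow> enat"
  where "elem_rank u = (SUP z. let S = spectrum (z * u) - {0} in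
    if finite S then enat (card S) else \<infinity>)"

text \<open>The integral of the resolvent, divided by \<open>2\<pi>i\<close>, over a circle around \<open>\<mu>\<close> which
  separates \<open>\<mu>\<close> from the rest of the spectrum; for an isolated point \<open>\<mu>\<close> of the spectrum the value
  does not depend on the radius.\<close>

definition riesz_idempotent :: "'a::complex_banach_algebra_1 \<Rightarrow> complex \<Rightarrow> 'a"
  where "riesz_idempotent x \<mu> =
    (let r = (SOME r::real. r > 0 \<and> spectrum x \<inter> cball \<mu> r \<subseteq> {\<mu>}) in
      (1 / (2 * of_real pi * \<i>)) *\<^sub>C
        integral {0..2 * pi} (\<lambda>t. (\<i> * of_real r * cis t) *\<^sub>C resolvent x (\<mu> + of_real r * cis t)))"

text \<open>Used for \<open>\<mu> \<noteq> 0\<close> and \<open>x\<close> in the socle, where the rank is finite.\<close>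

definition alg_mult :: "complex \<Rightarrow> 'a::complex_banach_algebra_1 \<Rightarrow> nat"
  where "alg_mult \<mu> x = the_enat (elem_rank (riesz_idempotent x \<mu>))"

text \<open>Elements of the socle have finite spectrum. The value of \<^const>\<open>alg_mult\<close> at \<open>\<mu> = 0\<close> is
  irrelevant.\<close>

definition soc_trace :: "'a::complex_banach_algebra_1 \<Rightarrow> complex"
  where "soc_trace x = (\<Sum>\<mu>\<in>spectrum x. of_nat (alg_mult \<mu> x) * \<mu>)"


section \<open>B-Fredholm and B-Weyl elements\<close>

definition B_Fredholm :: "'a::complex_banach_algebra_1 \<Rightarrow> bool"
  where "B_Fredholm a \<longleftrightarrow> drazin_invertible quotient_algebra (quotient_map a)"

definition drazin_inverse_mod_soc :: "'a::complex_banach_algebra_1 \<Rightarrow> 'a \<Rightarrow> bool"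
  where "drazin_inverse_mod_soc a a0 \<longleftrightarrow>
    drazin_inverse quotient_algebra (quotient_map a) (quotient_map a0)"

text \<open>The value does not depend on the chosen Drazin inverse modulo the socle.\<close>

definition B_index :: "'a::complex_banach_algebra_1 \<Rightarrow> complex"
  where "B_index a = (let a0 = (SOME a0. drazin_inverse_mod_soc a a0)
    in soc_trace (a * a0 - a0 * a))"

definition B_Weyl :: "'a::complex_banach_algebra_1 \<Rightarrow> bool"
  where "B_Weyl a \<longleftrightarrow> B_Fredholm a \<and> B_index a = 0"

end

theory Submission
  imports Defs "HOL-Complex_Analysis.Complex_Analysis"
begin

text \<open>Since \<open>A\<close> acts faithfully on \<open>Ap\<close>, the assumption on \<open>F\<^sub>0(Ap)\<close> identifies \<open>J\<close> with the elements \<open>x\<close> for which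
  \<open>x Ap\<close> is finite dimensional. An element \<open>x\<close> with \<open>g(x) \<in> J\<close> for some polynomial
  \<open>g \<noteq> 0\<close> is algebraic, so its Riesz idempotents are polynomials in \<open>x\<close>; summing over the spectrum,
  \<open>\<tau>\<close> is the trace of the operator \<open>y \<mapsto> x y\<close> on \<open>Ap\<close>, hence linear and zero on commutators
  with one factor in \<open>J\<close>. This gives one direction. For the other, let \<open>a\<^sub>0\<close> be a Drazin inverse
  of \<open>a\<close> modulo \<open>J\<close> and let \<open>P\<close> be the Riesz idempotent of \<open>a a\<^sub>0\<close> at \<open>1\<close>. Modulo \<open>J\<close>, \<open>a\<close>
  is the sum of \<open>U = P a P\<close>, which is Fredholm of index zero in \<open>P A P\<close> and therefore invertible
  there up to an element of \<open>J\<close>, and of \<open>Q = (1 - P) a (1 - P)\<close>, which is Drazin invertible because a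
  power of it lies in \<open>J\<close>.\<close>

section \<open>Algebraic elements and their Riesz idempotents\<close>

text \<open>The obstacle is that \<open>soc_trace\<close> is defined analytically, through contour
  integrals and suprema of spectrum sizes, while the argument needs linearity and cyclicity. A
  second trace \<open>tr\<close>, the sum of diagonal entries over a Hamel basis of Ap, has these
  properties by matrix computations; equality of the two reduces to idempotents, where both count
  dimensions. Operators on Ap are built inside A: elements of pA act as functionals because pAp
  consists of multiples of p, so y v with y in Ap and v in pA is an operator of rank at most one. In
  the index, a a0 and a0 a separately need not have a trace; only their difference lies in J. One
  factor of a commutator is therefore replaced at a time, by a congruent one
  (\<open>tr_commutator_cong\<close>). Idempotents lift from A/J because E = a a0 satisfies E^2 - E
  in J: this makes E algebraic, and its Riesz idempotent at 1 is congruent to E. Algebraicity also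
  turns nilpotency modulo J into Drazin invertibility in A.\<close>

lemmas scaleC_mult_simps = mult_scaleC_left mult_scaleC_right scaleC_scaleC

definition peval :: "complex poly \<Rightarrow> 'a::complex_banach_algebra_1 \<Rightarrow> 'a"
  where "peval f x = fold_coeffs (\<lambda>a y. a *\<^sub>C 1 + x * y) f 0"

lemma peval_0 [simp]: "peval 0 x = 0"
  by (simp add: peval_def)

lemma peval_pCons [simp]: "peval (pCons a f) x = a *\<^sub>C 1 + x * peval f x"
  by (cases "f = 0 \<and> a = 0") (auto simp: peval_def)

lemma peval_1 [simp]: "peval 1 x = 1"
  by (simp add: one_pCons scaleC_one)

lemma peval_add [simp]: "peval (f + g) x = peval f x + peval g x"
proof (induction f arbitrary: g)
  case (pCons a f)
  show ?case
    by (cases g) (simp add: pCons.IH scaleC_add_left distrib_left add.assoc add.left_commute)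
qed simp

lemma peval_smult [simp]: "peval (Polynomial.smult c f) x = c *\<^sub>C peval f x"
  by (induction f) (simp_all add: scaleC_add_right scaleC_mult_simps)

lemma peval_uminus [simp]: "peval (- f) x = - peval f x"
  using peval_smult[of "-1" f x] by (simp add: scaleC_one)

lemma peval_diff [simp]: "peval (f - g) x = peval f x - peval g x"
  using peval_add[of f "- g" x] by simp

lemma peval_sum: "peval (\<Sum>i\<in>I. f i) x = (\<Sum>i\<in>I. peval (f i) x)"
  by (induction I rule: infinite_finite_induct) auto

lemma peval_commute:
  assumes "x * y = y * x"
  shows "peval f x * y = y * peval f x"
proof (induction f)
  case (pCons a f)
  have "x * peval f x * y = x * y * peval f x"
    by (simp add: mult.assoc pCons.IH)
  then show ?case
    by (simp add: distrib_left distrib_right scaleC_mult_simps assms mult.assoc)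
qed simp

lemma peval_mult [simp]: "peval (f * g) x = peval f x * peval g x"
proof (induction f)
  case (pCons a f)
  show ?case
    by (simp add: pCons.IH distrib_right scaleC_mult_simps mult.assoc)
qed simp

lemma peval_power [simp]: "peval (f ^ n) x = peval f x ^ n"
  by (induction n) simp_all

lemma peval_dvd_eq_0: "f dvd g \<Longrightarrow> peval f x = 0 \<Longrightarrow> peval g x = 0"
  by (auto simp: dvd_def)

lemma peval_linear [simp]: "peval [:- \<mu>, 1:] x = x - \<mu> *\<^sub>C 1"
  by (simp add: scaleC_one)


section \<open>Inverses, spectrum and annihilating polynomials\<close>

lemma is_inverse_unique: "is_inverse x y \<Longrightarrow> is_inverse x z \<Longrightarrow> y = z"
  unfolding is_inverse_def by (metis mult.assoc mult_1_left mult_1_right)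

lemma resolvent_eqI: "is_inverse (\<mu> *\<^sub>C 1 - x) y \<Longrightarrow> resolvent x \<mu> = y"
  unfolding resolvent_def by (rule the_equality) (auto intro: is_inverse_unique)

lemma poly_linear_factor_remainder:
  fixes f :: "complex poly"
  obtains h where "f = [:- \<mu>, 1:] * h + [:poly f \<mu>:]"
proof -
  have "[:- \<mu>, 1:] dvd f - [:poly f \<mu>:]"
    by (simp add: poly_eq_0_iff_dvd[symmetric])
  then obtain h where "f - [:poly f \<mu>:] = [:- \<mu>, 1:] * h"
    by (auto simp: dvd_def)
  then show thesis
    by (intro that[of h]) (metis diff_add_cancel)
qed

text \<open>Division of f by X - \<mu> leaves the remainder f(\<mu>). Evaluated at x, this makes the
  quotient h(x) an inverse of \<mu> - x up to the scalar f(\<mu>), so this scalar must vanish on the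
  spectrum.\<close>

lemma spectrum_subset_roots:
  assumes "peval f x = 0"
  shows "spectrum x \<subseteq> {\<mu>. poly f \<mu> = 0}"
proof
  fix \<mu> assume mu: "\<mu> \<in> spectrum x"
  obtain h where h: "f = [:- \<mu>, 1:] * h + [:poly f \<mu>:]"
    by (rule poly_linear_factor_remainder)
  define c where "c = poly f \<mu>"
  have "(x - \<mu> *\<^sub>C 1) * peval h x + c *\<^sub>C 1 = peval ([:- \<mu>, 1:] * h + [:c:]) x"
    by (simp only: peval_add peval_mult peval_linear) simp
  also have "\<dots> = 0"
    using h assms unfolding c_def by metis
  finally have e: "(\<mu> *\<^sub>C 1 - x) * peval h x = c *\<^sub>C 1"
    by (simp add: algebra_simps add_eq_0_iff)
  have "(\<mu> *\<^sub>C 1 - x) * peval h x = peval h x * (\<mu> *\<^sub>C 1 - x)"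
    using peval_commute[of x x h] by (simp add: algebra_simps scaleC_mult_simps)
  then have "is_inverse (\<mu> *\<^sub>C 1 - x) ((1 / c) *\<^sub>C peval h x)" if "c \<noteq> 0"
    unfolding is_inverse_def using e that by (metis (no_types, opaque_lifting) mult_scaleC_left
      mult_scaleC_right scaleC_scaleC scaleC_one nonzero_divide_eq_eq)
  then have "c = 0"
    using mu unfolding spectrum_def by auto
  then show "\<mu> \<in> {\<mu>. poly f \<mu> = 0}"
    by (simp add: c_def)
qed

text \<open>The polynomial returned is a minimal polynomial: only then every root is a spectral value.\<close>

lemma minimal_polynomial:
  assumes "peval g x = 0" "g \<noteq> 0"
  obtains f where "f \<noteq> 0" "peval f x = 0" "spectrum x = {\<mu>. poly f \<mu> = 0}"
proof -
  define P where "P f \<longleftrightarrow> f \<noteq> 0 \<and> peval f x = 0" for f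
  define f where "f = arg_min Polynomial.degree P"
  have Pf: "P f" and min: "\<And>h. P h \<Longrightarrow> Polynomial.degree f \<le> Polynomial.degree h"
    using arg_min_nat_lemma[of P g Polynomial.degree] assms unfolding f_def P_def by blast+
  have "\<mu> \<in> spectrum x" if "poly f \<mu> = 0" for \<mu>
  proof (rule ccontr)
    assume "\<mu> \<notin> spectrum x"
    then obtain y where y: "y * (\<mu> *\<^sub>C 1 - x) = 1"
      unfolding spectrum_def is_inverse_def by auto
    obtain h where h: "f = [:- \<mu>, 1:] * h"
      using \<open>poly f \<mu> = 0\<close> by (auto simp: poly_eq_0_iff_dvd dvd_def)
    have "h \<noteq> 0"
      using h Pf unfolding P_def by auto
    have "(\<mu> *\<^sub>C 1 - x) * peval h x = - peval f x"
      unfolding h peval_mult peval_linear by (simp add: algebra_simps)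
    also have "\<dots> = 0"
      using Pf unfolding P_def by simp
    finally have "y * ((\<mu> *\<^sub>C 1 - x) * peval h x) = 0"
      by simp
    then have "peval h x = 0"
      by (simp add: mult.assoc[symmetric] y)
    then have "Polynomial.degree f \<le> Polynomial.degree h"
      using \<open>h \<noteq> 0\<close> by (intro min) (simp add: P_def)
    moreover have "Polynomial.degree f = Suc (Polynomial.degree h)"
      using \<open>h \<noteq> 0\<close> unfolding h by (subst degree_mult_eq) auto
    ultimately show False
      by simp
  qed
  then have "spectrum x = {\<mu>. poly f \<mu> = 0}"
    using spectrum_subset_roots[of f x] Pf unfolding P_def by auto
  then show thesis
    using Pf that unfolding P_def by blast
qed


text \<open>Chinese remainder theorem: h is 0 modulo g and 1 modulo a power of X - \<mu>. The
  exponent exceeds the order by one so that X - \<mu> divides 1 - h even if \<mu> is no root of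
  f.\<close>

lemma spectral_polynomial:
  fixes f :: "complex poly"
  assumes "f \<noteq> 0"
  obtains g h k where "f = [:- \<mu>, 1:] ^ Polynomial.order \<mu> f * g" "poly g \<mu> \<noteq> 0" "g dvd h"
    "1 - h = [:- \<mu>, 1:] ^ Suc (Polynomial.order \<mu> f) * k"
proof -
  obtain g where g: "f = [:- \<mu>, 1:] ^ Polynomial.order \<mu> f * g" "\<not> [:- \<mu>, 1:] dvd g"
    using order_decomp[OF assms] by blast
  have "coprime ([:- \<mu>, 1:] ^ Suc (Polynomial.order \<mu> f)) g"
    by (intro coprime_power_left_iff[THEN iffD2, OF disjI1] prime_elem_imp_coprime
      prime_elem_linear_field_poly g(2)) simp
  then obtain k b where kb: "k * [:- \<mu>, 1:] ^ Suc (Polynomial.order \<mu> f) + b * g = 1"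
    using bezout_coefficients_fst_snd[of "[:- \<mu>, 1:] ^ Suc (Polynomial.order \<mu> f)" g]
    by (metis coprime_imp_gcd_eq_1)
  show thesis
  proof (rule that[OF g(1)])
    show "poly g \<mu> \<noteq> 0"
      using g(2) by (simp add: poly_eq_0_iff_dvd)
    show "g dvd b * g"
      by simp
    show "1 - b * g = [:- \<mu>, 1:] ^ Suc (Polynomial.order \<mu> f) * k"
      using kb by (metis add_diff_cancel_right' mult.commute)
  qed
qed

section \<open>Contour integrals and the Riesz idempotent as a polynomial\<close>

lemma has_integral_scaleC_left:
  fixes a :: "'a::complex_banach_algebra_1"
  assumes "(\<phi> has_integral I) S"
  shows "((\<lambda>t. \<phi> t *\<^sub>C a) has_integral I *\<^sub>C a) S"
proof -
  have "bounded_linear (\<lambda>c. c *\<^sub>C a)"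
  proof (rule bounded_linear_intro[where K = "norm a"])
    show "(r *\<^sub>R c) *\<^sub>C a = r *\<^sub>R (c *\<^sub>C a)" for r c
      by (metis scaleR_conv_of_real scaleC_scaleC scaleC_of_real)
  qed (simp_all add: scaleC_add_left norm_scaleC)
  from has_integral_linear[OF assms this] show ?thesis
    by (simp add: o_def)
qed

lemma has_integral_mult_left_algebra:
  fixes x :: "'a::complex_banach_algebra_1"
  assumes "(F has_integral I) S"
  shows "((\<lambda>t. x * F t) has_integral x * I) S"
  using has_integral_linear[OF assms bounded_linear_mult_right[of x]] by (simp add: o_def)

lemma has_integral_mult_right_algebra:
  fixes x :: "'a::complex_banach_algebra_1"
  assumes "(F has_integral I) S"
  shows "((\<lambda>t. F t * x) has_integral I * x) S"
  using has_integral_linear[OF assms bounded_linear_mult_left[of x]] by (simp add: o_def)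

lemma circlepath_has_integral:
  assumes "(\<phi> has_contour_integral I) (circlepath \<mu> r)"
  shows "((\<lambda>t. \<i> * of_real r * cis t * \<phi> (\<mu> + of_real r * cis t)) has_integral I) {0..2 * pi}"
  using assms unfolding circlepath_def
  by (subst (asm) has_contour_integral_part_circlepath_iff) (auto simp: mult_ac)

lemma circle_integral_holomorphic:
  assumes "\<phi> holomorphic_on cball \<mu> r" "r > 0"
  shows "((\<lambda>t. \<i> * of_real r * cis t * \<phi> (\<mu> + of_real r * cis t)) has_integral 0) {0..2 * pi}"
  using assms by (intro circlepath_has_integral Cauchy_theorem_convex_simple[of _ "cball \<mu> r"])
    (auto simp: path_image_circlepath)

text \<open>Cauchy's formula for the j-th derivative at the centre, applied to the constant function
  1: only j = 0 gives a nonzero value.\<close>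

lemma circle_integral_inverse_power:
  assumes "r > 0"
  shows "((\<lambda>t. \<i> * of_real r * cis t * (1 / (\<mu> + of_real r * cis t - \<mu>) ^ Suc j)) has_integral
    (if j = 0 then 2 * of_real pi * \<i> else 0)) {0..2 * pi}"
proof (rule circlepath_has_integral)
  show "((\<lambda>u. 1 / (u - \<mu>) ^ Suc j) has_contour_integral
      (if j = 0 then 2 * of_real pi * \<i> else 0)) (circlepath \<mu> r)"
    using Cauchy_has_contour_integral_higher_derivative_circlepath[of \<mu> r "\<lambda>_. 1" \<mu> j] assms
    by (auto simp: higher_deriv_const)
qed

text \<open>The divided difference of a polynomial at \<open>x\<close> and \<open>\<zeta>\<close>. It is kept abstract; only that
  its products with holomorphic scalar functions have vanishing integrals matters.\<close>

lemma divided_difference_circle_integral: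
  fixes x :: "'a::complex_banach_algebra_1"
  assumes "r > 0"
  shows "\<exists>H. (\<forall>\<zeta>. (\<zeta> *\<^sub>C 1 - x) * H \<zeta> = poly g \<zeta> *\<^sub>C 1 - peval g x) \<and>
    (\<forall>\<phi>. \<phi> holomorphic_on cball \<mu> r \<longrightarrow>
      ((\<lambda>t. (\<i> * of_real r * cis t * \<phi> (\<mu> + of_real r * cis t)) *\<^sub>C H (\<mu> + of_real r * cis t))
        has_integral 0) {0..2 * pi})"
proof (induction g)
  case 0
  show ?case
    by (rule exI[of _ "\<lambda>_. 0"]) simp
next
  case (pCons a g)
  obtain H where H: "\<And>\<zeta>. (\<zeta> *\<^sub>C 1 - x) * H \<zeta> = poly g \<zeta> *\<^sub>C 1 - peval g x"
    and int: "\<And>\<phi>. \<phi> holomorphic_on cball \<mu> r \<Longrightarrow>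
      ((\<lambda>t. (\<i> * of_real r * cis t * \<phi> (\<mu> + of_real r * cis t)) *\<^sub>C H (\<mu> + of_real r * cis t))
        has_integral 0) {0..2 * pi}"
    using pCons.IH by blast
  \<comment> \<open>The recursion comes from \<zeta> g(\<zeta>) - x g(x) = x (g(\<zeta>) - g(x)) +
    (\<zeta> - x) g(\<zeta>).\<close>
  define H' where "H' \<zeta> = x * H \<zeta> + poly g \<zeta> *\<^sub>C 1" for \<zeta>
  have "(\<zeta> *\<^sub>C 1 - x) * H' \<zeta> = poly (pCons a g) \<zeta> *\<^sub>C 1 - peval (pCons a g) x" for \<zeta>
  proof -
    have "(\<zeta> *\<^sub>C 1 - x) * (x * H \<zeta>) = x * ((\<zeta> *\<^sub>C 1 - x) * H \<zeta>)"
      by (simp add: algebra_simps scaleC_mult_simps)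
    then show ?thesis
      unfolding H'_def distrib_left H
      by (simp add: algebra_simps scaleC_mult_simps scaleC_add_left)
  qed
  moreover have "((\<lambda>t. (\<i> * of_real r * cis t * \<phi> (\<mu> + of_real r * cis t)) *\<^sub>C H' (\<mu> + of_real r * cis t))
        has_integral 0) {0..2 * pi}" if "\<phi> holomorphic_on cball \<mu> r" for \<phi>
  proof -
    have "(\<lambda>z. \<phi> z * poly g z) holomorphic_on cball \<mu> r"
      by (intro holomorphic_intros that)
    from has_integral_add[OF has_integral_mult_left_algebra[OF int[OF that], of x]
      has_integral_scaleC_left[OF circle_integral_holomorphic[OF this assms], of "1::'a"]]
    show ?thesis
      by (simp add: H'_def scaleC_add_right scaleC_mult_simps mult_ac)
  qed
  ultimately show ?case
    by blast
qed

definition algebraic_element :: "'a::complex_banach_algebra_1 \<Rightarrow> bool"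
  where "algebraic_element x \<longleftrightarrow> (\<exists>f. f \<noteq> 0 \<and> peval f x = 0)"

lemma finite_spectrum_algebraic: "algebraic_element x \<Longrightarrow> finite (spectrum x)"
  unfolding algebraic_element_def using spectrum_subset_roots poly_roots_finite finite_subset by metis

text \<open>The Neumann series of (\<zeta> - \<mu>) - N with N = x - \<mu>, cut off because N^n q =
  0. The partial sums telescope.\<close>

lemma nilpotent_resolvent_sum:
  fixes x :: "'a::complex_banach_algebra_1"
  assumes "(x - \<mu> *\<^sub>C 1) ^ n * q = 0" "\<zeta> \<noteq> \<mu>"
  shows "(\<zeta> *\<^sub>C 1 - x) * (\<Sum>j<n. (1 / (\<zeta> - \<mu>) ^ Suc j) *\<^sub>C ((x - \<mu> *\<^sub>C 1) ^ j * q)) = q"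
proof -
  define w where "w = 1 / (\<zeta> - \<mu>)"
  define N where "N = x - \<mu> *\<^sub>C 1"
  have w: "w * (\<zeta> - \<mu>) = 1"
    using assms(2) by (simp add: w_def)
  have "\<zeta> *\<^sub>C 1 - x = (\<zeta> - \<mu>) *\<^sub>C 1 - N"
    by (simp add: N_def complex_vector.scale_left_diff_distrib)
  moreover have "((\<zeta> - \<mu>) *\<^sub>C 1 - N) * (\<Sum>j<n. w ^ Suc j *\<^sub>C (N ^ j * q)) = q - w ^ n *\<^sub>C (N ^ n * q)"
  proof (induction n)
    case (Suc n)
    have "((\<zeta> - \<mu>) *\<^sub>C 1 - N) * w ^ Suc n *\<^sub>C (N ^ n * q)
        = (w ^ n * (w * (\<zeta> - \<mu>))) *\<^sub>C (N ^ n * q) - w ^ Suc n *\<^sub>C (N ^ Suc n * q)"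
      by (simp add: algebra_simps scaleC_mult_simps)
    then show ?case
      by (simp only: sum.lessThan_Suc distrib_left Suc.IH w) simp
  qed (simp add: scaleC_one)
  ultimately show ?thesis
    using assms(1) by (simp add: N_def[symmetric] w_def power_one_over)
qed

text \<open>With q = h(x), the resolvent splits along q and 1 - q. On q it is a finite sum of
  negative powers of \<zeta> - \<mu>, whose first term alone has a nonzero integral, 2 pi i q. On 1
  - q, where g(x) vanishes, it is the divided difference of g over g(\<zeta>), with no singularity
  in the disc, so its integral is 0.\<close>

lemma riesz_idempotent_polynomial:
  assumes f: "f \<noteq> 0" "peval f x = 0" "spectrum x = {\<mu>. poly f \<mu> = 0}"
  obtains g h k where "f = [:- \<mu>, 1:] ^ Polynomial.order \<mu> f * g" "g dvd h"
    "1 - h = [:- \<mu>, 1:] ^ Suc (Polynomial.order \<mu> f) * k" "riesz_idempotent x \<mu> = peval h x"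
proof -
  define m where "m = Polynomial.order \<mu> f"
  obtain g h k where g: "f = [:- \<mu>, 1:] ^ m * g" "poly g \<mu> \<noteq> 0" and gh: "g dvd h"
    and hk: "1 - h = [:- \<mu>, 1:] ^ Suc m * k"
    using spectral_polynomial[OF f(1), of \<mu>] unfolding m_def by metis
  define q where "q = peval h x"
  \<comment> \<open>Literally the choice made in \<open>riesz_idempotent\<close>, so that its
    definition can be matched at the end.\<close>
  define r where "r = (SOME r::real. r > 0 \<and> spectrum x \<inter> cball \<mu> r \<subseteq> {\<mu>})"
  have "finite (spectrum x)"
    using f by (intro finite_spectrum_algebraic) (auto simp: algebraic_element_def)
  then obtain d where d: "d > 0" "\<And>z. z \<in> spectrum x \<Longrightarrow> z \<noteq> \<mu> \<Longrightarrow> d \<le> dist \<mu> z"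
    using finite_set_avoid[of "spectrum x" \<mu>] by blast
  have "\<exists>r>0. spectrum x \<inter> cball \<mu> r \<subseteq> {\<mu>}"
    using d by (intro exI[of _ "d / 2"]) fastforce
  then have r: "r > 0" "spectrum x \<inter> cball \<mu> r \<subseteq> {\<mu>}"
    unfolding r_def by (rule someI2_ex; blast)+
  define \<zeta> where "\<zeta> t = \<mu> + of_real r * cis t" for t
  have q_nil: "(x - \<mu> *\<^sub>C 1) ^ m * q = 0"
  proof -
    have "f dvd [:- \<mu>, 1:] ^ m * h"
      unfolding g(1) using gh by (rule mult_dvd_mono[OF dvd_refl])
    from peval_dvd_eq_0[OF this f(2)] show ?thesis
      by (simp only: peval_mult peval_power peval_linear q_def)
  qed
  have q_compl: "peval g x * (1 - q) = 0"
  proof -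
    have "f dvd g * (1 - h)"
      unfolding hk g(1) by (intro dvdI[of _ _ "[:- \<mu>, 1:] * k"]) (simp only: power_Suc mult_ac)
    from peval_dvd_eq_0[OF this f(2)] show ?thesis
      by (simp add: q_def)
  qed
  \<comment> \<open>Roots of g are roots of f, hence spectral values. The disc contains at most the
    value \<mu>, which is not a root of g.\<close>
  have g_nz: "poly g z \<noteq> 0" if "z \<in> cball \<mu> r" for z
    using that g r(2) f(3) by auto
  obtain H where H: "\<And>\<zeta>. (\<zeta> *\<^sub>C 1 - x) * H \<zeta> = poly g \<zeta> *\<^sub>C 1 - peval g x"
    and int: "\<And>\<phi>. \<phi> holomorphic_on cball \<mu> r \<Longrightarrow>
      ((\<lambda>t. (\<i> * of_real r * cis t * \<phi> (\<zeta> t)) *\<^sub>C H (\<zeta> t)) has_integral 0) {0..2 * pi}"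
    using divided_difference_circle_integral[OF r(1), of x g \<mu>] unfolding \<zeta>_def by blast
  define S where "S z = (\<Sum>j<m. (1 / (z - \<mu>) ^ Suc j) *\<^sub>C ((x - \<mu> *\<^sub>C 1) ^ j * q))" for z
  have res: "resolvent x (\<zeta> t) = S (\<zeta> t) + (1 / poly g (\<zeta> t)) *\<^sub>C H (\<zeta> t) * (1 - q)" for t
  proof -
    define z where "z = \<zeta> t"
    have z: "z \<noteq> \<mu>" "z \<in> cball \<mu> r"
      using r(1) by (auto simp: z_def \<zeta>_def dist_norm norm_mult)
    then have "z \<notin> spectrum x"
      using r(2) by auto
    then obtain y where y: "is_inverse (z *\<^sub>C 1 - x) y"
      by (auto simp: spectrum_def)
    define R where "R = S z + (1 / poly g z) *\<^sub>C H z * (1 - q)"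
    have "(z *\<^sub>C 1 - x) * S z = q"
      unfolding S_def using nilpotent_resolvent_sum[OF q_nil z(1)] .
    moreover have "(z *\<^sub>C 1 - x) * ((1 / poly g z) *\<^sub>C H z * (1 - q)) = 1 - q"
    proof -
      have "(z *\<^sub>C 1 - x) * ((1 / poly g z) *\<^sub>C H z * (1 - q))
          = (1 / poly g z) *\<^sub>C (((z *\<^sub>C 1 - x) * H z) * (1 - q))"
        by (simp only: scaleC_mult_simps mult.assoc)
      also have "\<dots> = (1 / poly g z) *\<^sub>C (poly g z *\<^sub>C (1 - q) - peval g x * (1 - q))"
        unfolding H by (simp add: left_diff_distrib scaleC_mult_simps)
      finally show ?thesis
        using g_nz[OF z(2)] by (simp add: q_compl scaleC_scaleC scaleC_one)
    qed
    ultimately have "(z *\<^sub>C 1 - x) * R = 1"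
      by (simp add: R_def distrib_left)
    then have "R = y"
      using y unfolding is_inverse_def by (metis mult.assoc mult_1_left mult_1_right)
    then show ?thesis
      using y resolvent_eqI unfolding R_def z_def by blast
  qed
  define I where "I j = (if j = 0 then 2 * of_real pi * \<i> else 0)" for j :: nat
  have "((\<lambda>t. (\<i> * of_real r * cis t) *\<^sub>C S (\<zeta> t)) has_integral
      (\<Sum>j<m. I j *\<^sub>C ((x - \<mu> *\<^sub>C 1) ^ j * q))) {0..2 * pi}"
  proof -
    have "((\<lambda>t. (\<i> * of_real r * cis t * (1 / (\<zeta> t - \<mu>) ^ Suc j)) *\<^sub>C ((x - \<mu> *\<^sub>C 1) ^ j * q))
      has_integral I j *\<^sub>C ((x - \<mu> *\<^sub>C 1) ^ j * q)) {0..2 * pi}" for j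
      unfolding I_def \<zeta>_def
      by (rule has_integral_scaleC_left[OF circle_integral_inverse_power[OF r(1)]])
    from has_integral_sum[OF finite_lessThan this] show ?thesis
      unfolding S_def complex_vector.scale_sum_right scaleC_scaleC .
  qed
  moreover have "(\<Sum>j<m. I j *\<^sub>C ((x - \<mu> *\<^sub>C 1) ^ j * q)) = (2 * of_real pi * \<i>) *\<^sub>C q"
  proof (cases m)
    \<comment> \<open>Here \<mu> is outside the spectrum, and \<open>q_nil\<close> with exponent 0
      says q = 0.\<close>
    case 0
    then show ?thesis
      using q_nil by simp
  next
    case (Suc n)
    show ?thesis
      unfolding Suc sum.lessThan_Suc_shift by (simp add: I_def)
  qed
  ultimately have "((\<lambda>t. (\<i> * of_real r * cis t) *\<^sub>C S (\<zeta> t)) has_integral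
      (2 * of_real pi * \<i>) *\<^sub>C q) {0..2 * pi}"
    by simp
  moreover have "((\<lambda>t. (\<i> * of_real r * cis t) *\<^sub>C ((1 / poly g (\<zeta> t)) *\<^sub>C H (\<zeta> t) * (1 - q)))
      has_integral 0) {0..2 * pi}"
  proof -
    have "(\<lambda>z. 1 / poly g z) holomorphic_on cball \<mu> r"
      by (intro holomorphic_intros g_nz)
    from has_integral_mult_right_algebra[OF int[OF this], of "1 - q"] show ?thesis
      by (simp add: scaleC_mult_simps)
  qed
  ultimately have "((\<lambda>t. (\<i> * of_real r * cis t) *\<^sub>C resolvent x (\<zeta> t)) has_integral
      (2 * of_real pi * \<i>) *\<^sub>C q) {0..2 * pi}"
    unfolding res scaleC_add_right by (rule has_integral_add[of _ _ _ _ 0, simplified])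
  then have "riesz_idempotent x \<mu> = q"
    unfolding riesz_idempotent_def Let_def r_def[symmetric] \<zeta>_def
    by (subst integral_unique, assumption) (simp add: scaleC_scaleC scaleC_one)
  then show thesis
    using that g(1) gh hk unfolding m_def q_def by blast
qed

section \<open>Spectral decomposition of algebraic elements\<close>

lemma bezout_linear_powers:
  fixes \<nu> \<mu> :: complex
  assumes "\<nu> \<noteq> \<mu>"
  obtains u v where "u * [:- \<nu>, 1:] ^ a + v * [:- \<mu>, 1:] ^ b = 1"
proof -
  have "coprime [:- \<nu>, 1:] [:- \<mu>, 1:]"
    using assms by (intro prime_elem_imp_coprime prime_elem_linear_field_poly)
      (auto simp: poly_eq_0_iff_dvd[symmetric])
  then have "coprime ([:- \<nu>, 1:] ^ a) ([:- \<mu>, 1:] ^ b)"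
    by (simp only: coprime_power_left_iff coprime_power_right_iff simp_thms)
  then show thesis
    using that bezout_coefficients_fst_snd[of "[:- \<nu>, 1:] ^ a" "[:- \<mu>, 1:] ^ b"]
    by (metis coprime_imp_gcd_eq_1)
qed

lemma algebraic_element_minimal:
  assumes "algebraic_element x"
  obtains f where "f \<noteq> 0" "peval f x = 0" "spectrum x = {\<mu>. poly f \<mu> = 0}"
  using assms minimal_polynomial unfolding algebraic_element_def by metis

lemma riesz_idempotent_is_peval:
  assumes "algebraic_element x"
  obtains h where "riesz_idempotent x \<mu> = peval h x"
  using algebraic_element_minimal[OF assms] riesz_idempotent_polynomial by metis

lemma riesz_idempotent_commute:
  assumes "algebraic_element x" "x * y = y * x"
  shows "riesz_idempotent x \<mu> * y = y * riesz_idempotent x \<mu>"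
  using riesz_idempotent_is_peval[OF assms(1), of \<mu>] peval_commute[OF assms(2)] by metis

lemma riesz_idempotent_nilpotent:
  assumes "algebraic_element x"
  obtains n where "(x - \<mu> *\<^sub>C 1) ^ n * riesz_idempotent x \<mu> = 0"
proof -
  obtain f where f: "f \<noteq> 0" "peval f x = 0" "spectrum x = {\<mu>. poly f \<mu> = 0}"
    by (rule algebraic_element_minimal[OF assms])
  obtain g h where gh: "f = [:- \<mu>, 1:] ^ Polynomial.order \<mu> f * g" "g dvd h"
    "riesz_idempotent x \<mu> = peval h x"
    by (rule riesz_idempotent_polynomial[OF f])
  have "f dvd [:- \<mu>, 1:] ^ Polynomial.order \<mu> f * h"
    by (subst (1) gh(1)) (rule mult_dvd_mono[OF dvd_refl gh(2)])
  from peval_dvd_eq_0[OF this f(2)] that show thesis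
    by (simp only: peval_mult peval_power peval_linear gh(3))
qed

lemma one_minus_riesz_idempotent:
  assumes "algebraic_element x"
  obtains k where "1 - riesz_idempotent x \<mu> = (x - \<mu> *\<^sub>C 1) * peval k x"
proof -
  obtain f where f: "f \<noteq> 0" "peval f x = 0" "spectrum x = {\<mu>. poly f \<mu> = 0}"
    by (rule algebraic_element_minimal[OF assms])
  obtain h k where "1 - h = [:- \<mu>, 1:] ^ Suc (Polynomial.order \<mu> f) * k"
    "riesz_idempotent x \<mu> = peval h x"
    by (rule riesz_idempotent_polynomial[OF f])
  then have "1 - riesz_idempotent x \<mu> = peval ([:- \<mu>, 1:] * ([:- \<mu>, 1:] ^ Polynomial.order \<mu> f * k)) x"
    by (metis peval_1 peval_diff power_Suc mult.assoc)
  then show thesis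
    using that unfolding peval_mult[of "[:- \<mu>, 1:]"] peval_linear by blast
qed

text \<open>On the range of the idempotent, x - \<nu> is a nonzero scalar plus a nilpotent element,
  hence invertible. With \<nu> = 0 this lets the idempotent inherit properties of x that pass to
  multiples, such as finite rank.\<close>

lemma riesz_idempotent_in_range:
  assumes "algebraic_element x" "\<nu> \<noteq> \<mu>"
  obtains u where "riesz_idempotent x \<mu> = (x - \<nu> *\<^sub>C 1) * u"
proof -
  define q where "q = riesz_idempotent x \<mu>"
  obtain n where n: "(x - \<mu> *\<^sub>C 1) ^ n * q = 0"
    using riesz_idempotent_nilpotent[OF assms(1)] unfolding q_def by metis
  obtain u v where uv: "u * [:- \<nu>, 1:] ^ 1 + v * [:- \<mu>, 1:] ^ n = 1"
    by (rule bezout_linear_powers[OF assms(2)])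
  have "q = peval ([:- \<nu>, 1:] * u + v * [:- \<mu>, 1:] ^ n) x * q"
    using uv by (simp add: mult.commute)
  also have "\<dots> = (x - \<nu> *\<^sub>C 1) * (peval u x * q)"
    unfolding peval_add peval_mult peval_power peval_linear distrib_right
    by (simp add: mult.assoc n)
  finally show thesis
    using that q_def by blast
qed

text \<open>The product is killed by powers of both x - \<nu> and x - \<mu>, and these powers
  generate the unit ideal.\<close>

lemma riesz_idempotents_orthogonal:
  assumes "algebraic_element x" "\<nu> \<noteq> \<mu>"
  shows "riesz_idempotent x \<nu> * riesz_idempotent x \<mu> = 0"
proof -
  obtain l m where l: "(x - \<nu> *\<^sub>C 1) ^ l * riesz_idempotent x \<nu> = 0"
    and m: "(x - \<mu> *\<^sub>C 1) ^ m * riesz_idempotent x \<mu> = 0"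
    using riesz_idempotent_nilpotent[OF assms(1)] by metis
  obtain u v where uv: "u * [:- \<nu>, 1:] ^ l + v * [:- \<mu>, 1:] ^ m = 1"
    by (rule bezout_linear_powers[OF assms(2)])
  have comm: "riesz_idempotent x \<nu> * riesz_idempotent x \<mu> = riesz_idempotent x \<mu> * riesz_idempotent x \<nu>"
    by (intro riesz_idempotent_commute[symmetric, OF assms(1)] riesz_idempotent_commute assms(1)) simp
  have "riesz_idempotent x \<nu> * riesz_idempotent x \<mu>
    = peval (u * [:- \<nu>, 1:] ^ l + v * [:- \<mu>, 1:] ^ m) x * (riesz_idempotent x \<nu> * riesz_idempotent x \<mu>)"
    unfolding uv by simp
  also have "\<dots> = peval u x * ((x - \<nu> *\<^sub>C 1) ^ l * riesz_idempotent x \<nu> * riesz_idempotent x \<mu>)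
    + peval v x * ((x - \<mu> *\<^sub>C 1) ^ m * riesz_idempotent x \<mu> * riesz_idempotent x \<nu>)"
    unfolding peval_add peval_mult peval_power peval_linear distrib_right
    by (simp add: mult.assoc comm)
  finally show ?thesis
    by (simp add: l m)
qed

lemma riesz_idempotent_idem:
  assumes "algebraic_element x"
  shows "riesz_idempotent x \<mu> * riesz_idempotent x \<mu> = riesz_idempotent x \<mu>"
proof -
  obtain f where f: "f \<noteq> 0" "peval f x = 0" "spectrum x = {\<mu>. poly f \<mu> = 0}"
    by (rule algebraic_element_minimal[OF assms])
  obtain g h k where gh: "f = [:- \<mu>, 1:] ^ Polynomial.order \<mu> f * g" "g dvd h"
    "1 - h = [:- \<mu>, 1:] ^ Suc (Polynomial.order \<mu> f) * k"
    "riesz_idempotent x \<mu> = peval h x"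
    by (rule riesz_idempotent_polynomial[OF f])
  obtain d where d: "h = g * d"
    using gh(2) by (auto simp: dvd_def)
  have "(1 - h) * h = [:- \<mu>, 1:] ^ Polynomial.order \<mu> f * g * ([:- \<mu>, 1:] * k * d)"
    unfolding gh(3) by (simp only: d power_Suc mult_ac)
  then have "f dvd (1 - h) * h"
    unfolding gh(1)[symmetric] by simp
  from peval_dvd_eq_0[OF this f(2)] show ?thesis
    by (simp add: gh(4) algebra_simps)
qed

text \<open>If the idempotent were 0, the factorization of 1 minus it would provide an inverse of x
  - \<mu>.\<close>

lemma riesz_idempotent_nonzero:
  assumes "algebraic_element x" "\<mu> \<in> spectrum x"
  shows "riesz_idempotent x \<mu> \<noteq> 0"
proof
  assume 0: "riesz_idempotent x \<mu> = 0"
  obtain k where k: "1 - riesz_idempotent x \<mu> = (x - \<mu> *\<^sub>C 1) * peval k x"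
    by (rule one_minus_riesz_idempotent[OF assms(1)])
  have "(x - \<mu> *\<^sub>C 1) * peval k x = peval k x * (x - \<mu> *\<^sub>C 1)"
    using peval_commute[of x x k] by (simp add: algebra_simps scaleC_mult_simps)
  then have "is_inverse (\<mu> *\<^sub>C 1 - x) (- peval k x)"
    using k 0 unfolding is_inverse_def minus_diff_eq[of x "\<mu> *\<^sub>C 1", symmetric] minus_mult_minus by simp
  then show False
    using assms(2) by (auto simp: spectrum_def)
qed

text \<open>By orthogonality, 1 minus the sum is the product of the complements, and each complement
  contributes the full power of its linear factor. Over the whole spectrum these powers multiply to
  f up to a constant, and f(x) = 0.\<close>

lemma sum_riesz_idempotents:
  assumes "algebraic_element x"
  shows "(\<Sum>\<mu>\<in>spectrum x. riesz_idempotent x \<mu>) = 1"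
proof -
  obtain f where f: "f \<noteq> 0" "peval f x = 0" "spectrum x = {\<mu>. poly f \<mu> = 0}"
    by (rule algebraic_element_minimal[OF assms])
  define q where "q = riesz_idempotent x"
  have "\<exists>c. 1 - (\<Sum>\<mu>\<in>S. q \<mu>) = peval ((\<Prod>\<mu>\<in>S. [:- \<mu>, 1:] ^ Polynomial.order \<mu> f) * c) x"
    if "finite S" for S
    using that
  proof (induction S)
    case empty
    show ?case
      by (rule exI[of _ 1]) simp
  next
    case (insert \<nu> S)
    obtain c where c: "1 - (\<Sum>\<mu>\<in>S. q \<mu>) = peval ((\<Prod>\<mu>\<in>S. [:- \<mu>, 1:] ^ Polynomial.order \<mu> f) * c) x"
      using insert.IH by blast
    obtain h k where hk: "1 - h = [:- \<nu>, 1:] ^ Suc (Polynomial.order \<nu> f) * k" "q \<nu> = peval h x"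
      unfolding q_def by (rule riesz_idempotent_polynomial[OF f])
    have "(\<Sum>\<mu>\<in>S. q \<mu>) * q \<nu> = 0"
      unfolding sum_distrib_right q_def using insert.hyps riesz_idempotents_orthogonal[OF assms]
      by (intro sum.neutral) metis
    then have "1 - (\<Sum>\<mu>\<in>insert \<nu> S. q \<mu>) = (1 - (\<Sum>\<mu>\<in>S. q \<mu>)) * (1 - q \<nu>)"
      using insert.hyps by (simp add: algebra_simps)
    also have "1 - q \<nu> = peval ([:- \<nu>, 1:] ^ Suc (Polynomial.order \<nu> f) * k) x"
      unfolding hk(1)[symmetric] by (simp add: hk(2))
    also have "(1 - (\<Sum>\<mu>\<in>S. q \<mu>)) * \<dots> = peval (((\<Prod>\<mu>\<in>S. [:- \<mu>, 1:] ^ Polynomial.order \<mu> f) * c)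
      * ([:- \<nu>, 1:] ^ Suc (Polynomial.order \<nu> f) * k)) x"
      unfolding c peval_mult ..
    also have "((\<Prod>\<mu>\<in>S. [:- \<mu>, 1:] ^ Polynomial.order \<mu> f) * c)
      * ([:- \<nu>, 1:] ^ Suc (Polynomial.order \<nu> f) * k)
      = (\<Prod>\<mu>\<in>insert \<nu> S. [:- \<mu>, 1:] ^ Polynomial.order \<mu> f) * (c * k * [:- \<nu>, 1:])"
      by (simp only: prod.insert[OF insert.hyps] power_Suc mult_ac)
    finally show ?case
      by blast
  qed
  from this[of "spectrum x"] finite_spectrum_algebraic[OF assms]
  obtain c where c: "1 - (\<Sum>\<mu>\<in>spectrum x. q \<mu>)
      = peval ((\<Prod>\<mu>\<in>spectrum x. [:- \<mu>, 1:] ^ Polynomial.order \<mu> f) * c) x"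
    by blast
  have "f dvd (\<Prod>\<mu>\<in>spectrum x. [:- \<mu>, 1:] ^ Polynomial.order \<mu> f)"
  proof -
    define P where "P = (\<Prod>\<mu>\<in>spectrum x. [:- \<mu>, 1:] ^ Polynomial.order \<mu> f)"
    have "Polynomial.smult (Polynomial.lead_coeff f) P = f"
      unfolding P_def f(3) by (rule complex_poly_decompose)
    then have "P = Polynomial.smult (inverse (Polynomial.lead_coeff f)) f"
      using f(1) by (metis Polynomial.smult_smult left_inverse leading_coeff_0_iff Polynomial.smult_1_left)
    then show ?thesis
      unfolding P_def[symmetric] using dvd_smult[OF dvd_refl] by metis
  qed
  then have "f dvd (\<Prod>\<mu>\<in>spectrum x. [:- \<mu>, 1:] ^ Polynomial.order \<mu> f) * c"
    by (rule dvd_mult2)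
  from peval_dvd_eq_0[OF this f(2)] c show ?thesis
    by (simp add: q_def)
qed

section \<open>Drazin inverses of algebraic elements\<close>

lemma drazin_inverse_ring_of_type_algebra:
  "drazin_inverse ring_of_type_algebra x y \<longleftrightarrow>
    y * x * y = y \<and> x * y = y * x \<and> (\<exists>k. x ^ k * y * x = x ^ k)"
proof -
  have "x [^]\<^bsub>ring_of_type_algebra\<^esub> k = x ^ k" for k :: nat
    by (induction k) (simp_all add: ring_of_type_algebra_def nat_pow_def power_commutes)
  then show ?thesis
    by (auto simp: drazin_inverse_def ring_of_type_algebra_def)
qed

lemma algebraic_element_drazin_inverse:
  assumes "algebraic_element x"
  obtains y k where "y * x * y = y" "x * y = y * x" "x ^ k * (1 - y * x) = 0"
proof -
  define q where "q = riesz_idempotent x 0"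
  have q: "q * q = q"
    unfolding q_def by (rule riesz_idempotent_idem[OF assms])
  obtain h where h: "1 - q = x * peval h x"
    using one_minus_riesz_idempotent[OF assms, of 0] by (auto simp: q_def)
  obtain k where k: "x ^ k * q = 0"
    using riesz_idempotent_nilpotent[OF assms, of 0] by (auto simp: q_def)
  have hx: "peval h x * x = x * peval h x"
    by (rule peval_commute) simp
  have qx: "q * x = x * q" and qh: "q * peval h x = peval h x * q"
    unfolding q_def by (rule riesz_idempotent_commute[OF assms]; simp add: hx)+
  \<comment> \<open>The element y inverts x on the range of 1 - q and vanishes on the range of q,
    where x is nilpotent.\<close>
  define y where "y = peval h x * (1 - q)"
  have idem: "(1 - q) * (1 - q) = 1 - q"
    by (simp add: algebra_simps q)
  have comm: "(1 - q) * x = x * (1 - q)" "(1 - q) * peval h x = peval h x * (1 - q)"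
    by (simp_all add: left_diff_distrib right_diff_distrib qx qh)
  have yx: "y * x = 1 - q"
    unfolding y_def by (metis comm(1) h hx idem mult.assoc)
  have xy: "x * y = 1 - q"
    unfolding y_def mult.assoc[symmetric] h[symmetric] idem ..
  show thesis
  proof (rule that[of y k])
    show "y * x * y = y"
      unfolding yx unfolding y_def by (metis comm(2) idem mult.assoc)
    show "x * y = y * x"
      by (simp add: xy yx)
    show "x ^ k * (1 - y * x) = 0"
      by (simp add: yx k)
  qed
qed


section \<open>Finite rank elements of a prime algebra\<close>

lemma mult_span_image:
  "y \<in> complex_vector.span B \<Longrightarrow> a * y \<in> complex_vector.span ((*) a ` B)"
proof (induction rule: complex_vector.span_induct_alt)
  case (step c b y)
  then have "a * b \<in> complex_vector.span ((*) a ` B)"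
    by (intro complex_vector.span_base imageI)
  then have "c *\<^sub>C (a * b) + a * y \<in> complex_vector.span ((*) a ` B)"
    by (intro complex_vector.span_add complex_vector.span_scale step.IH)
  then show ?case
    by (simp add: distrib_left scaleC_mult_simps)
qed (simp add: complex_vector.span_zero)

text \<open>The first assumption is primeness in terms of elements, the form in which primitivity
  enters the proof.\<close>

locale prime_with_minimal_idempotent =
  fixes p :: "'a::complex_banach_algebra_1"
  assumes prime: "(\<And>z::'a. a * z * b = 0) \<Longrightarrow> a = 0 \<or> b = 0"
    and p: "minimal_idempotent p"
begin

abbreviation Ap :: "'a set"
  where "Ap \<equiv> principal_left_ideal p"

definition finite_rank :: "'a \<Rightarrow> bool"
  where "finite_rank x \<longleftrightarrow> (\<exists>B. finite B \<and> (*) x ` Ap \<subseteq> complex_vector.span B)"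

lemma p_nonzero: "p \<noteq> 0" and p_idem: "p * p = p"
  and corner_p: "\<exists>c. p * x * p = c *\<^sub>C p"
  using p unfolding minimal_idempotent_def by (auto dest: equalityD1)

lemma in_Ap_iff: "y \<in> Ap \<longleftrightarrow> y * p = y"
  unfolding principal_left_ideal_def by (auto simp: mult.assoc p_idem) (metis rangeI)

lemma p_in_Ap: "p \<in> Ap"
  by (simp add: in_Ap_iff p_idem)

lemma mult_in_Ap: "y \<in> Ap \<Longrightarrow> a * y \<in> Ap"
  by (simp add: in_Ap_iff mult.assoc)

lemma subspace_Ap: "complex_vector.subspace Ap"
  by (auto simp: complex_vector.subspace_def in_Ap_iff distrib_right scaleC_mult_simps)

lemma faithful: "(\<And>y. y \<in> Ap \<Longrightarrow> x * y = z * y) \<Longrightarrow> x = z"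
proof -
  assume *: "\<And>y. y \<in> Ap \<Longrightarrow> x * y = z * y"
  have "(x - z) * w * p = 0" for w
    using *[of "w * p"] by (simp add: left_diff_distrib mult.assoc principal_left_ideal_def)
  then show "x = z"
    using prime[of "x - z" p] p_nonzero by auto
qed

text \<open>Elements of pA act on Ap as linear functionals: v y lies in pAp, which consists of the
  scalar multiples of p. The element p takes the part of the scalar 1.\<close>

lemma functional:
  assumes "p * v = v" "y \<in> Ap"
  obtains c where "v * y = c *\<^sub>C p"
  using corner_p[of "v * y"] assms by (auto simp: in_Ap_iff mult.assoc[symmetric]) (metis mult.assoc)

text \<open>Primeness says that pA does not annihilate a nonzero y; rescaling makes the value equal
  to p.\<close>

lemma separating_functional:
  assumes "y \<in> Ap" "y \<noteq> 0"
  obtains w where "p * w = w" "w * y = p"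
proof -
  obtain z where z: "p * z * y \<noteq> 0"
    using prime[of p y] p_nonzero assms(2) by blast
  obtain c where c: "p * z * y = c *\<^sub>C p"
    using functional[of "p * z" y] assms(1) p_idem by (metis mult.assoc)
  with z have "c \<noteq> 0"
    by auto
  then show thesis
    using c p_idem by (intro that[of "(1 / c) *\<^sub>C (p * z)"])
      (simp_all add: scaleC_mult_simps scaleC_one mult.assoc[symmetric])
qed

lemma finite_rankI:
  "finite B \<Longrightarrow> (\<And>y. y \<in> Ap \<Longrightarrow> x * y \<in> complex_vector.span B) \<Longrightarrow> finite_rank x"
  unfolding finite_rank_def by blast

lemma finite_rank_0: "finite_rank 0"
  by (rule finite_rankI[of "{}"]) auto

lemma finite_rank_add:
  assumes "finite_rank x" "finite_rank y"
  shows "finite_rank (x + y)"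
proof -
  obtain B C where "finite B" "(*) x ` Ap \<subseteq> complex_vector.span B"
    "finite C" "(*) y ` Ap \<subseteq> complex_vector.span C"
    using assms unfolding finite_rank_def by blast
  then show ?thesis
    by (intro finite_rankI[of "B \<union> C"])
      (auto simp: distrib_right image_subset_iff intro!: complex_vector.span_add
        intro: subsetD[OF complex_vector.span_mono, rotated])
qed

lemma finite_rank_mult_left:
  assumes "finite_rank x"
  shows "finite_rank (a * x)"
proof -
  obtain B where "finite B" "(*) x ` Ap \<subseteq> complex_vector.span B"
    using assms unfolding finite_rank_def by blast
  then show ?thesis
    by (intro finite_rankI[of "(*) a ` B"]) (auto simp: mult.assoc intro!: mult_span_image)
qed

lemma finite_rank_mult_right: "finite_rank x \<Longrightarrow> finite_rank (x * a)"
  unfolding finite_rank_def by (auto simp: mult.assoc image_subset_iff mult_in_Ap)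

lemma finite_rank_uminus: "finite_rank x \<Longrightarrow> finite_rank (- x)"
  using finite_rank_mult_left[of x "- 1"] by simp

lemma finite_rank_diff: "finite_rank x \<Longrightarrow> finite_rank y \<Longrightarrow> finite_rank (x - y)"
  using finite_rank_add[of x "- y"] finite_rank_uminus[of y] by simp

lemma finite_rank_scaleC: "finite_rank x \<Longrightarrow> finite_rank (c *\<^sub>C x)"
  using finite_rank_mult_left[of x "c *\<^sub>C 1"] by (simp add: scaleC_mult_simps)

lemma finite_rank_sum: "(\<And>i. i \<in> I \<Longrightarrow> finite_rank (f i)) \<Longrightarrow> finite_rank (\<Sum>i\<in>I. f i)"
  by (induction I rule: infinite_finite_induct) (auto intro: finite_rank_0 finite_rank_add)

lemma finite_rank_Ap:
  assumes "y \<in> Ap"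
  shows "finite_rank y"
proof -
  have "finite_rank p"
  proof (rule finite_rankI[of "{p}"])
    fix y assume "y \<in> Ap"
    then obtain c where "p * y = c *\<^sub>C p"
      using functional p_idem by blast
    then show "p * y \<in> complex_vector.span {p}"
      by (simp add: complex_vector.span_base complex_vector.span_scale)
  qed simp
  then show ?thesis
    using finite_rank_mult_left[of p y] assms by (simp add: in_Ap_iff)
qed

section \<open>Bases of ranges, dual functionals and generalized inverses\<close>

definition range_basis :: "'a \<Rightarrow> 'a set \<Rightarrow> bool"
  where "range_basis x B \<longleftrightarrow> finite B \<and> \<not> complex_vector.dependent B \<and>
    B \<subseteq> (*) x ` Ap \<and> (*) x ` Ap \<subseteq> complex_vector.span B"

lemma range_basis_in_range:
  assumes "range_basis x B" "b \<in> B"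
  shows "\<exists>y\<in>Ap. b = x * y"
proof -
  have "b \<in> (*) x ` Ap"
    using assms unfolding range_basis_def by (metis subsetD)
  then show ?thesis
    by (metis imageE)
qed

lemma range_basis_subset_Ap: "range_basis x B \<Longrightarrow> B \<subseteq> Ap"
  unfolding range_basis_def using mult_in_Ap by blast

lemma ex_range_basis:
  assumes "finite_rank x"
  obtains B where "range_basis x B"
proof -
  obtain C where C: "finite C" "(*) x ` Ap \<subseteq> complex_vector.span C"
    using assms unfolding finite_rank_def by blast
  obtain B where B: "B \<subseteq> (*) x ` Ap" "\<not> complex_vector.dependent B" "(*) x ` Ap \<subseteq> complex_vector.span B"
    using complex_vector.maximal_independent_subset by blast
  then have "finite B"
    using complex_vector.independent_span_bound[of C B] C by blast
  then show thesis
    using that B unfolding range_basis_def by blast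
qed

text \<open>The dual basis of B, realized inside pA. For b in Ap the product \<open>b * v b\<close>
  is then an idempotent of rank one, and the sum of these products projects onto the span of
  B.\<close>

definition dual_system :: "'a set \<Rightarrow> ('a \<Rightarrow> 'a) \<Rightarrow> bool"
  where "dual_system B v \<longleftrightarrow> (\<forall>b\<in>B. p * v b = v b \<and> (\<forall>c\<in>B. v b * c = (if b = c then p else 0)))"

lemma dual_system_projection:
  assumes "finite B" "B \<subseteq> Ap" "dual_system B v"
  shows "y \<in> complex_vector.span B \<Longrightarrow> (\<Sum>b\<in>B. b * v b) * y = y"
    and "y \<in> Ap \<Longrightarrow> (\<Sum>b\<in>B. b * v b) * y \<in> complex_vector.span B"
proof -
  have base: "(\<Sum>b\<in>B. b * v b) * c = c" if "c \<in> B" for c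
  proof -
    have "(\<Sum>b\<in>B. b * v b) * c = (\<Sum>b\<in>B. if c = b then b else 0)"
      unfolding sum_distrib_right using assms that
      by (intro sum.cong) (auto simp: mult.assoc dual_system_def in_Ap_iff)
    then show ?thesis
      using assms(1) that by simp
  qed
  show "y \<in> complex_vector.span B \<Longrightarrow> (\<Sum>b\<in>B. b * v b) * y = y"
    by (induction rule: complex_vector.span_induct_alt)
      (simp_all add: distrib_left scaleC_mult_simps base)
  show "(\<Sum>b\<in>B. b * v b) * y \<in> complex_vector.span B" if y: "y \<in> Ap"
    unfolding sum_distrib_right
  proof (rule complex_vector.span_sum)
    fix b assume b: "b \<in> B"
    then obtain c where c: "v b * y = c *\<^sub>C p"
      using functional[OF _ y, of "v b"] assms(3) unfolding dual_system_def by blast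
    have "b * v b * y = c *\<^sub>C b"
      using b assms(2) by (auto simp: mult.assoc c scaleC_mult_simps in_Ap_iff)
    then show "b * v b * y \<in> complex_vector.span B"
      using b by (simp add: complex_vector.span_base complex_vector.span_scale)
  qed
qed

text \<open>Biorthogonalization. A functional separating y - Q y from 0, composed with 1 - Q,
  vanishes on B and is p at y; a multiple of it is subtracted from each old functional so that the
  latter vanishes at y.\<close>

lemma ex_dual_system:
  assumes "finite B" "\<not> complex_vector.dependent B" "B \<subseteq> Ap"
  shows "\<exists>v. dual_system B v"
  using assms
proof (induction B)
  case empty
  then show ?case
    by (simp add: dual_system_def)
next
  case (insert y B)
  have ind: "\<not> complex_vector.dependent B" and y: "y \<notin> complex_vector.span B"
    using insert.prems(1) insert.hyps(2) by (auto simp: complex_vector.independent_insert)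
  then obtain v where v: "dual_system B v"
    using insert by auto
  define Q where "Q = (\<Sum>b\<in>B. b * v b)"
  note Q = dual_system_projection[OF insert.hyps(1) _ v, folded Q_def]
  have Ap: "y \<in> Ap" "B \<subseteq> Ap"
    using insert.prems by auto
  have "y - Q * y \<noteq> 0"
    using Q(2)[of y] Ap y by auto
  moreover have "y - Q * y \<in> Ap"
    using Ap mult_in_Ap subspace_Ap by (simp add: complex_vector.subspace_diff)
  ultimately obtain w where w: "p * w = w" "w * (y - Q * y) = p"
    by (metis separating_functional)
  define u where "u = w * (1 - Q)"
  have u: "p * u = u" "u * y = p" "\<And>c. c \<in> B \<Longrightarrow> u * c = 0"
    using w Q(1) Ap by (simp_all add: u_def mult.assoc[symmetric])
      (simp_all add: mult.assoc left_diff_distrib complex_vector.span_base)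
  define v' where "v' b = (if b = y then u else v b - v b * y * u)" for b
  have "dual_system (insert y B) v'"
    unfolding dual_system_def
  proof (intro ballI conjI)
    fix b assume b: "b \<in> insert y B"
    show "p * v' b = v' b"
      using b v u(1) by (auto simp: v'_def dual_system_def right_diff_distrib mult.assoc[symmetric])
    fix c assume c: "c \<in> insert y B"
    show "v' b * c = (if b = c then p else 0)"
      using b c v u(2,3) insert.hyps(2) Ap
      by (auto simp: v'_def dual_system_def left_diff_distrib mult.assoc in_Ap_iff)
  qed
  then show ?case
    by blast
qed

text \<open>With s sending each basis vector of the range to a preimage, x s is the projection onto
  the range of x.\<close>

lemma finite_rank_regular:
  assumes "finite_rank x"
  obtains s where "x * s * x = x"
proof -
  obtain B where B: "range_basis x B"
    by (rule ex_range_basis[OF assms])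
  then obtain v where v: "dual_system B v"
    using ex_dual_system[of B] range_basis_subset_Ap[OF B] unfolding range_basis_def by auto
  have "\<forall>b\<in>B. \<exists>u. x * u = b"
    using range_basis_in_range[OF B] by metis
  then obtain u where u: "\<And>b. b \<in> B \<Longrightarrow> x * u b = b"
    by metis
  define s where "s = (\<Sum>b\<in>B. u b * v b)"
  have "x * s = (\<Sum>b\<in>B. b * v b)"
    unfolding s_def sum_distrib_left by (intro sum.cong) (simp_all add: mult.assoc[symmetric] u)
  moreover have "(\<Sum>b\<in>B. b * v b) * x = x"
  proof (rule faithful)
    fix y assume "y \<in> Ap"
    then have "x * y \<in> complex_vector.span B"
      using B unfolding range_basis_def by blast
    then show "(\<Sum>b\<in>B. b * v b) * x * y = x * y"
      using B dual_system_projection(1)[OF _ range_basis_subset_Ap[OF B] v]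
      unfolding range_basis_def mult.assoc by blast
  qed
  ultimately show thesis
    using that by metis
qed

section \<open>Algebraicity from a finite rank polynomial value\<close>

lemma annihilating_polynomial:
  assumes "finite B" "\<And>i. x ^ i * b \<in> complex_vector.span B"
  obtains f where "f \<noteq> 0" "peval f x * b = 0"
proof -
  have monom: "peval (Polynomial.monom c i) x = c *\<^sub>C x ^ i" for c i
    by (induction i) (simp_all add: monom_Suc monom_0 scaleC_mult_simps)
  define n where "n = card B"
  \<comment> \<open>Linear dependence is a property of sets, so two coinciding vectors x^i b would
    be invisible to it; they yield a difference of monomials directly.\<close>
  show thesis
  proof (cases "inj_on (\<lambda>i. x ^ i * b) {..n}")
    case False
    then obtain i j where ij: "i \<noteq> j" "x ^ i * b = x ^ j * b"
      by (auto simp: inj_on_def)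
    show thesis
    proof (rule that[of "Polynomial.monom 1 i - Polynomial.monom 1 j"])
      show "Polynomial.monom 1 i - Polynomial.monom 1 j \<noteq> (0 :: complex poly)"
        using ij(1) by (simp add: monom_eq_iff')
      show "peval (Polynomial.monom 1 i - Polynomial.monom 1 j) x * b = 0"
        using ij(2) by (simp add: monom scaleC_one left_diff_distrib)
    qed
  next
    case inj: True
    define S where "S = (\<lambda>i. x ^ i * b) ` {..n}"
    have "card S = Suc n"
      unfolding S_def using inj by (simp add: card_image)
    moreover have "S \<subseteq> complex_vector.span B"
      using assms(2) by (auto simp: S_def)
    ultimately have "complex_vector.dependent S"
      using complex_vector.independent_span_bound[OF assms(1), of S] unfolding n_def by auto
    moreover have "finite S"
      by (simp add: S_def)
    ultimately obtain u v where u: "v \<in> S" "u v \<noteq> 0" "(\<Sum>v\<in>S. u v *\<^sub>C v) = 0"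
      by (auto simp: complex_vector.dependent_finite)
    define f where "f = (\<Sum>i\<le>n. Polynomial.monom (u (x ^ i * b)) i)"
    have coeff_f: "Polynomial.coeff f i = u (x ^ i * b)" if "i \<le> n" for i
      using that by (simp add: f_def coeff_sum)
    show thesis
    proof (rule that[of f])
      obtain i where "i \<le> n" "v = x ^ i * b"
        using u(1) by (auto simp: S_def)
      then have "Polynomial.coeff f i \<noteq> 0"
        using u(2) coeff_f by simp
      then show "f \<noteq> 0"
        by auto
      have "peval f x * b = (\<Sum>i\<le>n. u (x ^ i * b) *\<^sub>C (x ^ i * b))"
        unfolding f_def peval_sum monom sum_distrib_right by (simp add: scaleC_mult_simps)
      also have "\<dots> = 0"
        using u(3) unfolding S_def by (simp add: sum.reindex[OF inj])
      finally show "peval f x * b = 0" .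
    qed
  qed
qed

text \<open>The range of g(x) on Ap is finite dimensional and invariant under x. A product F of
  polynomials annihilating its basis vectors annihilates it, so F g vanishes at x by
  faithfulness.\<close>

lemma algebraic_of_finite_rank_peval:
  assumes "g \<noteq> 0" "finite_rank (peval g x)"
  shows "algebraic_element x"
proof -
  obtain B where B: "range_basis (peval g x) B"
    by (rule ex_range_basis[OF assms(2)])
  have "\<exists>f. f \<noteq> 0 \<and> peval f x * b = 0" if "b \<in> B" for b
  proof -
    obtain y where y: "y \<in> Ap" "b = peval g x * y"
      using range_basis_in_range[OF B \<open>b \<in> B\<close>] by metis
    have "x ^ i * b = peval g x * (x ^ i * y)" for i
    proof -
      have "peval g x * x ^ i = x ^ i * peval g x"
        by (rule peval_commute) (simp add: power_commutes)
      then show ?thesis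
        unfolding y(2) by (simp only: mult.assoc[symmetric])
    qed
    moreover have "peval g x * (x ^ i * y) \<in> complex_vector.span B" for i
      using B mult_in_Ap[OF y(1)] unfolding range_basis_def by blast
    ultimately have "x ^ i * b \<in> complex_vector.span B" for i
      by metis
    moreover have "finite B"
      using B unfolding range_basis_def by blast
    ultimately obtain f where "f \<noteq> 0" "peval f x * b = 0"
      using annihilating_polynomial by blast
    then show ?thesis
      by blast
  qed
  then obtain f where f: "\<And>b. b \<in> B \<Longrightarrow> f b \<noteq> 0 \<and> peval (f b) x * b = 0"
    by metis
  define F where "F = (\<Prod>b\<in>B. f b)"
  have fin: "finite B"
    using B by (simp add: range_basis_def)
  have base: "peval F x * b = 0" if "b \<in> B" for b
  proof -
    have "F = (\<Prod>c\<in>B - {b}. f c) * f b"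
      unfolding F_def using fin that by (simp add: prod.remove mult.commute)
    then show ?thesis
      using f[OF that] by (simp add: mult.assoc)
  qed
  have "peval F x * y = 0" if "y \<in> complex_vector.span B" for y
    using that by (induction rule: complex_vector.span_induct_alt)
      (simp_all add: distrib_left scaleC_mult_simps base)
  then have "peval (F * g) x * y = 0 * y" if "y \<in> Ap" for y
    using that B unfolding range_basis_def by (auto simp: mult.assoc)
  then have "peval (F * g) x = 0"
    by (rule faithful)
  moreover have "F * g \<noteq> 0"
    using f fin assms(1) by (auto simp: F_def)
  ultimately show ?thesis
    unfolding algebraic_element_def by blast
qed

lemma algebraic_of_finite_rank: "finite_rank x \<Longrightarrow> algebraic_element x"
  using algebraic_of_finite_rank_peval[of "[:0, 1:]" x] by (simp add: scaleC_one)


section \<open>The trace of finite rank elements\<close>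

text \<open>The basis is made to contain p so that the trace of p can be read off as a single
  diagonal entry.\<close>

definition hamel_basis :: "'a set"
  where "hamel_basis = (SOME H. p \<in> H \<and> H \<subseteq> Ap \<and> \<not> complex_vector.dependent H \<and>
    Ap \<subseteq> complex_vector.span H)"

lemma hamel_basis:
  shows p_in_hamel_basis: "p \<in> hamel_basis"
    and hamel_basis_subset: "hamel_basis \<subseteq> Ap"
    and independent_hamel_basis: "\<not> complex_vector.dependent hamel_basis"
    and span_hamel_basis: "Ap \<subseteq> complex_vector.span hamel_basis"
proof -
  have "\<not> complex_vector.dependent {p}"
    using p_nonzero by simp
  moreover have "{p} \<subseteq> Ap"
    using p_in_Ap by simp
  ultimately obtain H where "{p} \<subseteq> H" "H \<subseteq> Ap" "\<not> complex_vector.dependent H" "Ap \<subseteq> complex_vector.span H"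
    using complex_vector.maximal_independent_subset_extend by metis
  then have "\<exists>H. p \<in> H \<and> H \<subseteq> Ap \<and> \<not> complex_vector.dependent H \<and> Ap \<subseteq> complex_vector.span H"
    by (metis insert_subset)
  from someI_ex[OF this, folded hamel_basis_def]
  show "p \<in> hamel_basis" "hamel_basis \<subseteq> Ap" "\<not> complex_vector.dependent hamel_basis"
    "Ap \<subseteq> complex_vector.span hamel_basis"
    by blast+
qed

definition coord :: "'a \<Rightarrow> 'a \<Rightarrow> complex"
  where "coord b y = complex_vector.representation hamel_basis y b"

lemma in_span_hamel_basis: "y \<in> Ap \<Longrightarrow> y \<in> complex_vector.span hamel_basis"
  using span_hamel_basis by (rule subsetD)

lemma coord_add: "y \<in> Ap \<Longrightarrow> z \<in> Ap \<Longrightarrow> coord b (y + z) = coord b y + coord b z"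
  unfolding coord_def
  by (subst complex_vector.representation_add[OF independent_hamel_basis])
    (auto intro: in_span_hamel_basis)

lemma coord_scaleC: "y \<in> Ap \<Longrightarrow> coord b (c *\<^sub>C y) = c * coord b y"
  unfolding coord_def
  by (subst complex_vector.representation_scale[OF independent_hamel_basis])
    (auto intro: in_span_hamel_basis)

lemma coord_sum: "(\<And>i. i \<in> I \<Longrightarrow> y i \<in> Ap) \<Longrightarrow> coord b (\<Sum>i\<in>I. y i) = (\<Sum>i\<in>I. coord b (y i))"
  unfolding coord_def
  by (subst complex_vector.representation_sum[OF independent_hamel_basis])
    (auto intro: in_span_hamel_basis)

lemma coord_outside:
  assumes "B \<subseteq> hamel_basis" "y \<in> complex_vector.span B" "b \<notin> B"
  shows "coord b y = 0"
  using complex_vector.representation_extend[OF independent_hamel_basis assms(2,1)]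
    complex_vector.representation_ne_zero[of B y b] assms(3) unfolding coord_def by auto

lemma coord_expansion:
  assumes "finite B" "B \<subseteq> hamel_basis" "y \<in> complex_vector.span B"
  shows "(\<Sum>b\<in>B. coord b y *\<^sub>C b) = y"
proof -
  have "\<not> complex_vector.dependent B"
    using assms(2) independent_hamel_basis complex_vector.dependent_mono by blast
  then show ?thesis
    using complex_vector.sum_representation_eq[of B y B] assms
      complex_vector.representation_extend[OF independent_hamel_basis assms(3,2)]
    unfolding coord_def by auto
qed

lemma finite_hamel_support:
  assumes "finite B" "B \<subseteq> Ap"
  obtains C where "finite C" "C \<subseteq> hamel_basis" "B \<subseteq> complex_vector.span C"
proof
  let ?C = "\<Union>y\<in>B. {b. complex_vector.representation hamel_basis y b \<noteq> 0}"
  show "finite ?C"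
    using assms(1) complex_vector.finite_representation by auto
  show "?C \<subseteq> hamel_basis"
    using complex_vector.representation_ne_zero by auto
  show "B \<subseteq> complex_vector.span ?C"
  proof
    fix y assume y: "y \<in> B"
    then have "(\<Sum>b | complex_vector.representation hamel_basis y b \<noteq> 0.
        complex_vector.representation hamel_basis y b *\<^sub>C b) = y"
      using assms(2) by (intro complex_vector.sum_nonzero_representation_eq independent_hamel_basis
        in_span_hamel_basis) auto
    moreover have "(\<Sum>b | complex_vector.representation hamel_basis y b \<noteq> 0.
        complex_vector.representation hamel_basis y b *\<^sub>C b) \<in> complex_vector.span ?C"
      using y by (intro complex_vector.span_sum complex_vector.span_scale complex_vector.span_base) auto
    ultimately show "y \<in> complex_vector.span ?C"
      by simp
  qed
qed

text \<open>A finite part of the basis that carries the range of x. It may be enlarged, so that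
  several traces can be computed over a common finite index set.\<close>

definition hamel_support :: "'a \<Rightarrow> 'a set \<Rightarrow> bool"
  where "hamel_support x C \<longleftrightarrow> finite C \<and> C \<subseteq> hamel_basis \<and>
    (\<forall>y\<in>Ap. x * y \<in> complex_vector.span C)"

lemma ex_hamel_support:
  assumes "finite_rank x"
  obtains C where "hamel_support x C"
proof -
  obtain B where B: "range_basis x B"
    by (rule ex_range_basis[OF assms])
  then have "finite B"
    by (simp add: range_basis_def)
  then obtain C where C: "finite C" "C \<subseteq> hamel_basis" "B \<subseteq> complex_vector.span C"
    using finite_hamel_support range_basis_subset_Ap[OF B] by metis
  have "complex_vector.span B \<subseteq> complex_vector.span C"
    using C(3) by (simp add: complex_vector.span_minimal complex_vector.subspace_span)
  moreover have "(*) x ` Ap \<subseteq> complex_vector.span B"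
    using B by (simp add: range_basis_def)
  ultimately have "hamel_support x C"
    using C(1,2) unfolding hamel_support_def by (meson image_subset_iff subsetD)
  then show thesis
    by (rule that)
qed

lemma hamel_support_mono:
  assumes "hamel_support x C" "finite D" "D \<subseteq> hamel_basis" "C \<subseteq> D"
  shows "hamel_support x D"
  using assms complex_vector.span_mono[OF assms(4)] unfolding hamel_support_def by (meson subsetD)

text \<open>The sum is over the diagonal entries of the matrix of left multiplication by \<open>x\<close> on \<open>Ap\<close>
  with respect to a Hamel basis; for \<open>x\<close> of finite rank only finitely many of them are nonzero.\<close>

definition tr :: "'a \<Rightarrow> complex"
  where "tr x = (\<Sum>b | b \<in> hamel_basis \<and> coord b (x * b) \<noteq> 0. coord b (x * b))"

lemma tr_eq:
  assumes "hamel_support x C"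
  shows "tr x = (\<Sum>b\<in>C. coord b (x * b))"
  unfolding tr_def
proof (rule sum.mono_neutral_left)
  show "finite C"
    using assms by (simp add: hamel_support_def)
  have "coord b (x * b) = 0" if "b \<in> hamel_basis" "b \<notin> C" for b
    using that assms hamel_basis_subset coord_outside[of C "x * b" b] unfolding hamel_support_def by blast
  then show "{b \<in> hamel_basis. coord b (x * b) \<noteq> 0} \<subseteq> C"
    by blast
  show "\<forall>b\<in>C - {b \<in> hamel_basis. coord b (x * b) \<noteq> 0}. coord b (x * b) = 0"
    using assms by (auto simp: hamel_support_def)
qed

lemma tr_add:
  assumes "finite_rank x" "finite_rank y"
  shows "tr (x + y) = tr x + tr y"
proof -
  obtain C D where C: "hamel_support x C" and D: "hamel_support y D"
    using assms ex_hamel_support by metis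
  have fin: "finite (C \<union> D)" "C \<union> D \<subseteq> hamel_basis"
    using C D by (auto simp: hamel_support_def)
  have x: "hamel_support x (C \<union> D)" and y: "hamel_support y (C \<union> D)"
    using hamel_support_mono[OF C fin] hamel_support_mono[OF D fin] by auto
  then have xy: "hamel_support (x + y) (C \<union> D)"
    unfolding hamel_support_def by (simp add: distrib_right complex_vector.span_add)
  have "coord b ((x + y) * b) = coord b (x * b) + coord b (y * b)" if "b \<in> C \<union> D" for b
  proof -
    have "b \<in> Ap"
      using that fin(2) hamel_basis_subset by blast
    then show ?thesis
      unfolding distrib_right by (intro coord_add mult_in_Ap)
  qed
  then show ?thesis
    unfolding tr_eq[OF x] tr_eq[OF y] tr_eq[OF xy] by (simp add: sum.distrib)
qed

lemma tr_scaleC: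
  assumes "finite_rank x"
  shows "tr (c *\<^sub>C x) = c * tr x"
proof -
  obtain C where C: "hamel_support x C"
    by (rule ex_hamel_support[OF assms])
  then have cx: "hamel_support (c *\<^sub>C x) C"
    by (simp add: hamel_support_def scaleC_mult_simps complex_vector.span_scale)
  have "coord b (c *\<^sub>C x * b) = c * coord b (x * b)" if "b \<in> C" for b
  proof -
    have "b \<in> Ap"
      using that C hamel_basis_subset unfolding hamel_support_def by blast
    then show ?thesis
      unfolding mult_scaleC_left by (intro coord_scaleC mult_in_Ap)
  qed
  then show ?thesis
    unfolding tr_eq[OF C] tr_eq[OF cx] by (simp add: sum_distrib_left)
qed

lemma tr_diff: "finite_rank x \<Longrightarrow> finite_rank y \<Longrightarrow> tr (x - y) = tr x - tr y"
  using tr_add[of x "- 1 *\<^sub>C y"] tr_scaleC[of y "- 1"] finite_rank_scaleC[of y "- 1"]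
  by (simp add: scaleC_one)

lemma tr_0: "tr 0 = 0"
  using tr_diff[OF finite_rank_0 finite_rank_0] by simp

lemma tr_sum: "(\<And>i. i \<in> I \<Longrightarrow> finite_rank (f i)) \<Longrightarrow> tr (\<Sum>i\<in>I. f i) = (\<Sum>i\<in>I. tr (f i))"
  by (induction I rule: infinite_finite_induct) (auto simp: tr_0 tr_add finite_rank_sum)

text \<open>As for matrices, both traces are the same double sum. Only x has finite rank: C carries
  its range, and D is chosen to carry the image of C under y, hence the range of y x, so both sums
  are finite.\<close>

lemma tr_commute:
  assumes "finite_rank x"
  shows "tr (x * y) = tr (y * x)"
proof -
  obtain C where C: "hamel_support x C"
    by (rule ex_hamel_support[OF assms])
  then have finC: "finite C" "C \<subseteq> Ap"
    using hamel_basis_subset by (auto simp: hamel_support_def)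
  obtain D0 where D0: "finite D0" "D0 \<subseteq> hamel_basis" "(*) y ` C \<subseteq> complex_vector.span D0"
    using finite_hamel_support[of "(*) y ` C"] finC mult_in_Ap by blast
  define D where "D = C \<union> D0"
  have D: "finite D" "D \<subseteq> hamel_basis" "D \<subseteq> Ap" "C \<subseteq> D"
    using C D0 hamel_basis_subset unfolding D_def hamel_support_def by auto
  have yC: "y * b \<in> complex_vector.span D" if "b \<in> C" for b
    using that D0(3) complex_vector.span_mono[of D0 D] unfolding D_def by blast
  have xy: "hamel_support (x * y) C"
    using C mult_in_Ap unfolding hamel_support_def by (simp add: mult.assoc)
  have yx: "hamel_support (y * x) D"
    unfolding hamel_support_def
  proof (intro conjI ballI D)
    fix z assume "z \<in> Ap"
    then have "x * z \<in> complex_vector.span C"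
      using C by (simp add: hamel_support_def)
    then have "y * (x * z) \<in> complex_vector.span ((*) y ` C)"
      by (rule mult_span_image)
    moreover have "complex_vector.span ((*) y ` C) \<subseteq> complex_vector.span D"
      using yC by (intro complex_vector.span_minimal complex_vector.subspace_span) auto
    ultimately show "y * x * z \<in> complex_vector.span D"
      by (auto simp: mult.assoc)
  qed
  have "tr (x * y) = (\<Sum>b\<in>C. \<Sum>c\<in>D. coord c (y * b) * coord b (x * c))"
    unfolding tr_eq[OF xy]
  proof (rule sum.cong[OF refl])
    fix b assume b: "b \<in> C"
    have "x * y * b = x * (\<Sum>c\<in>D. coord c (y * b) *\<^sub>C c)"
      using coord_expansion[OF D(1,2) yC[OF b]] by (simp add: mult.assoc)
    also have "\<dots> = (\<Sum>c\<in>D. coord c (y * b) *\<^sub>C (x * c))"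
      by (simp add: sum_distrib_left scaleC_mult_simps)
    also have "coord b \<dots> = (\<Sum>c\<in>D. coord b (coord c (y * b) *\<^sub>C (x * c)))"
      using D(3) mult_in_Ap complex_vector.subspace_scale[OF subspace_Ap] by (intro coord_sum) blast
    also have "\<dots> = (\<Sum>c\<in>D. coord c (y * b) * coord b (x * c))"
      using D(3) mult_in_Ap by (intro sum.cong coord_scaleC) blast+
    finally show "coord b (x * y * b) = \<dots>" .
  qed
  also have "\<dots> = (\<Sum>c\<in>D. \<Sum>b\<in>C. coord b (x * c) * coord c (y * b))"
    by (subst sum.swap) (simp add: mult.commute)
  also have "\<dots> = tr (y * x)"
    unfolding tr_eq[OF yx]
  proof (rule sum.cong[OF refl])
    fix c assume c: "c \<in> D"
    have "x * c \<in> complex_vector.span C"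
      using C D(3) c unfolding hamel_support_def by blast
    then have "y * x * c = y * (\<Sum>b\<in>C. coord b (x * c) *\<^sub>C b)"
      using coord_expansion[OF finC(1), of "x * c"] C by (simp add: hamel_support_def mult.assoc)
    also have "\<dots> = (\<Sum>b\<in>C. coord b (x * c) *\<^sub>C (y * b))"
      by (simp add: sum_distrib_left scaleC_mult_simps)
    also have "coord c \<dots> = (\<Sum>b\<in>C. coord c (coord b (x * c) *\<^sub>C (y * b)))"
      using finC(2) mult_in_Ap complex_vector.subspace_scale[OF subspace_Ap] by (intro coord_sum) blast
    also have "\<dots> = (\<Sum>b\<in>C. coord b (x * c) * coord c (y * b))"
      using finC(2) mult_in_Ap by (intro sum.cong coord_scaleC) blast+
    finally show "(\<Sum>b\<in>C. coord b (x * c) * coord c (y * b)) = coord c (y * x * c)" ..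
  qed
  finally show ?thesis .
qed

lemma tr_p: "tr p = 1"
proof -
  have "hamel_support p {p}"
    unfolding hamel_support_def
  proof (intro conjI ballI)
    fix y assume "y \<in> Ap"
    then obtain c where "p * y = c *\<^sub>C p"
      using functional p_idem by blast
    then show "p * y \<in> complex_vector.span {p}"
      by (simp add: complex_vector.span_base complex_vector.span_scale)
  qed (simp_all add: p_in_hamel_basis)
  from tr_eq[OF this] show ?thesis
    using complex_vector.representation_basis[OF independent_hamel_basis p_in_hamel_basis]
    by (simp add: p_idem coord_def)
qed

section \<open>Traces of idempotent and nilpotent elements\<close>

lemma idempotent_range_basis:
  assumes "e * e = e" "range_basis e B"
  shows "b \<in> B \<Longrightarrow> e * b = b"
    and "dual_system B v \<Longrightarrow> (\<Sum>b\<in>B. b * v b) * e = e"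
proof -
  show "b \<in> B \<Longrightarrow> e * b = b"
    using range_basis_in_range[OF assms(2)] assms(1) by (metis mult.assoc)
  assume v: "dual_system B v"
  show "(\<Sum>b\<in>B. b * v b) * e = e"
  proof (rule faithful)
    fix y assume "y \<in> Ap"
    then have "e * y \<in> complex_vector.span B"
      using assms(2) unfolding range_basis_def by (meson image_subset_iff)
    then show "(\<Sum>b\<in>B. b * v b) * e * y = e * y"
      using dual_system_projection(1)[OF _ range_basis_subset_Ap[OF assms(2)] v] assms(2)
      unfolding range_basis_def mult.assoc by metis
  qed
qed

lemma ex_range_dual:
  assumes "finite_rank x"
  obtains B v where "range_basis x B" "dual_system B v"
proof -
  obtain B where B: "range_basis x B"
    by (rule ex_range_basis[OF assms])
  then show thesis
    using that ex_dual_system[of B] range_basis_subset_Ap[OF B] unfolding range_basis_def by metis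
qed

text \<open>The element e is the sum of the products b (v b) e, and by cyclicity each has the trace
  of (v b) e b = p, which is 1.\<close>

lemma tr_idempotent:
  assumes "e * e = e" "range_basis e B"
  shows "tr e = of_nat (card B)"
proof -
  have sub: "B \<subseteq> Ap"
    by (rule range_basis_subset_Ap[OF assms(2)])
  obtain v where v: "dual_system B v"
    using ex_dual_system[of B] sub assms(2) unfolding range_basis_def by metis
  have b: "tr (b * v b * e) = 1" "finite_rank (b * v b * e)" if "b \<in> B" for b
  proof -
    have fin: "finite_rank b"
      using that sub by (intro finite_rank_Ap) blast
    then show "finite_rank (b * v b * e)"
      by (intro finite_rank_mult_right)
    have "tr (b * v b * e) = tr (v b * (e * b))"
      using tr_commute[OF fin, of "v b * e"] by (simp add: mult.assoc)
    also have "v b * (e * b) = p"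
      using idempotent_range_basis(1)[OF assms that] v that unfolding dual_system_def by simp
    finally show "tr (b * v b * e) = 1"
      by (simp add: tr_p)
  qed
  have "tr e = tr (\<Sum>b\<in>B. b * v b * e)"
    using idempotent_range_basis(2)[OF assms v] by (simp add: sum_distrib_right)
  also have "\<dots> = (\<Sum>b\<in>B. tr (b * v b * e))"
    by (intro tr_sum b(2))
  also have "\<dots> = of_nat (card B)"
    using b(1) by simp
  finally show ?thesis .
qed

lemma tr_idempotent_nat:
  assumes "e * e = e" "finite_rank e"
  obtains n :: nat where "tr e = of_nat n" "e \<noteq> 0 \<Longrightarrow> n > 0"
proof -
  obtain B v where B: "range_basis e B" "dual_system B v"
    by (rule ex_range_dual[OF assms(2)])
  have "card B > 0" if "e \<noteq> 0"
  proof -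
    have "B \<noteq> {}"
      using idempotent_range_basis(2)[OF assms(1) B] that by auto
    then show ?thesis
      using B(1) by (simp add: range_basis_def card_gt_0_iff)
  qed
  then show thesis
    using that tr_idempotent[OF assms(1) B(1)] by blast
qed

text \<open>With \<open>e = n s\<close> for a generalized inverse \<open>s\<close> of \<open>n\<close>, the element \<open>n e\<close> has the same trace
  as \<open>n = e n\<close> but a smaller index of nilpotency.\<close>

lemma tr_nilpotent: "finite_rank n \<Longrightarrow> n ^ k = 0 \<Longrightarrow> tr n = 0"
proof (induction k arbitrary: n)
  case 0
  then have "n = 0"
    by (metis mult_1_left mult_zero_left power_0)
  then show ?case
    by (simp add: tr_0)
next
  case (Suc k)
  obtain s where s: "n * s * n = n"
    by (rule finite_rank_regular[OF Suc.prems(1)])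
  define e where "e = n * s"
  have en: "e * n = n"
    by (simp add: e_def s)
  have pow: "(n * e) ^ Suc j = n ^ Suc j * e" for j
  proof (induction j)
    case (Suc j)
    have "(n * e) ^ Suc (Suc j) = n * (e * n) * n ^ j * e"
      unfolding power_Suc[of "n * e" "Suc j"] Suc.IH by (simp only: power_Suc mult.assoc)
    then show ?case
      by (simp add: en mult.assoc)
  qed simp
  \<comment> \<open>For k > 0 the power is n^k e = n^(k+1) s = 0. For k = 0 it would be 1, but then
    n itself is 0.\<close>
  have "(n * e) ^ k = 0 \<or> k = 0 \<and> n = 0"
  proof (cases k)
    case 0
    then show ?thesis
      using Suc.prems(2) by simp
  next
    case (Suc j)
    have "(n * e) ^ k = n ^ Suc k * s"
      unfolding Suc pow by (simp only: e_def mult.assoc[symmetric] power_Suc2)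
    then show ?thesis
      using Suc.prems(2) by simp
  qed
  moreover have "tr n = tr (n * e)"
    using tr_commute[OF Suc.prems(1), of e] en by simp
  ultimately show ?case
    using Suc.IH[of "n * e"] finite_rank_mult_right[OF Suc.prems(1)] tr_0 by auto
qed

text \<open>Murray-von Neumann equivalence: equal traces mean ranges of equal dimension. A bijection
  between bases of the ranges and the dual functionals give z, carrying the range of f to that of e,
  and its inverse w.\<close>

lemma equivalent_idempotents:
  assumes "e * e = e" "finite_rank e" "f * f = f" "finite_rank f" "tr e = tr f"
  obtains z w where "z * w = e" "w * z = f" "e * z = z" "z * f = z" "f * w = w" "w * e = w" "finite_rank z"
proof -
  obtain B v where B: "range_basis e B" and v: "dual_system B v"
    by (rule ex_range_dual[OF assms(2)])
  obtain C u where C: "range_basis f C" and u: "dual_system C u"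
    by (rule ex_range_dual[OF assms(4)])
  have fin: "finite B" "finite C"
    using B C by (auto simp: range_basis_def)
  have "card B = card C"
    using assms(5) tr_idempotent[OF assms(1) B] tr_idempotent[OF assms(3) C] by simp
  then obtain \<phi> where \<phi>: "bij_betw \<phi> B C"
    using fin finite_same_card_bij by blast
  have \<phi>C: "\<phi> b \<in> C" if "b \<in> B" for b
    using \<phi> that bij_betwE by blast
  have \<phi>_eq: "\<phi> b = \<phi> c \<longleftrightarrow> b = c" if "b \<in> B" "c \<in> B" for b c
    using \<phi> that by (auto simp: bij_betw_def inj_on_def)
  note e = idempotent_range_basis[OF assms(1) B]
  note f = idempotent_range_basis[OF assms(3) C]
  have BX: "b * p = b" if "b \<in> B" for b
    using that range_basis_subset_Ap[OF B] by (auto simp: in_Ap_iff)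
  have CX: "c * p = c" if "c \<in> C" for c
    using that range_basis_subset_Ap[OF C] by (auto simp: in_Ap_iff)
  define z where "z = (\<Sum>b\<in>B. b * u (\<phi> b) * f)"
  define w where "w = (\<Sum>b\<in>B. \<phi> b * v b * e)"
  have zw: "z * w = e"
  proof -
    have "b * u (\<phi> b) * f * (\<phi> c * v c * e) = (if b = c then b * v b * e else 0)"
      if "b \<in> B" "c \<in> B" for b c
    proof -
      have "b * u (\<phi> b) * f * (\<phi> c * v c * e) = b * (u (\<phi> b) * (f * \<phi> c)) * v c * e"
        by (simp only: mult.assoc)
      also have "f * \<phi> c = \<phi> c"
        using f(1) \<phi>C that by blast
      also have "u (\<phi> b) * \<phi> c = (if b = c then p else 0)"
        using u \<phi>C that \<phi>_eq unfolding dual_system_def by simp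
      finally show ?thesis
        using BX that by simp
    qed
    then have "z * w = (\<Sum>b\<in>B. \<Sum>c\<in>B. if b = c then b * v b * e else 0)"
      unfolding z_def w_def sum_product by (intro sum.cong refl) simp
    also have "\<dots> = (\<Sum>b\<in>B. b * v b) * e"
      unfolding sum_distrib_right using fin by (intro sum.cong refl) simp
    finally show ?thesis
      using e(2)[OF v] by simp
  qed
  have wz: "w * z = f"
  proof -
    have "\<phi> b * v b * e * (c * u (\<phi> c) * f) = (if b = c then \<phi> b * u (\<phi> b) * f else 0)"
      if "b \<in> B" "c \<in> B" for b c
    proof -
      have "\<phi> b * v b * e * (c * u (\<phi> c) * f) = \<phi> b * (v b * (e * c)) * u (\<phi> c) * f"
        by (simp only: mult.assoc)
      also have "e * c = c"
        using e(1) that by blast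
      also have "v b * c = (if b = c then p else 0)"
        using v that unfolding dual_system_def by simp
      finally show ?thesis
        using CX \<phi>C that by simp
    qed
    then have "w * z = (\<Sum>b\<in>B. \<Sum>c\<in>B. if b = c then \<phi> b * u (\<phi> b) * f else 0)"
      unfolding z_def w_def sum_product by (intro sum.cong refl) simp
    also have "\<dots> = (\<Sum>b\<in>B. \<phi> b * u (\<phi> b)) * f"
      unfolding sum_distrib_right using fin by (intro sum.cong refl) simp
    also have "(\<Sum>b\<in>B. \<phi> b * u (\<phi> b)) = (\<Sum>c\<in>C. c * u c)"
      using sum.reindex_bij_betw[OF \<phi>, of "\<lambda>c. c * u c"] by simp
    finally show ?thesis
      using f(2)[OF u] by simp
  qed
  show thesis
  proof (rule that[OF zw wz])
    show "e * z = z"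
      unfolding z_def sum_distrib_left
      by (intro sum.cong refl) (simp add: e(1) mult.assoc[symmetric])
    show "z * f = z"
      unfolding z_def sum_distrib_right by (intro sum.cong refl) (simp add: assms(3) mult.assoc)
    show "f * w = w"
      unfolding w_def sum_distrib_left
      by (intro sum.cong refl) (simp add: f(1) \<phi>C mult.assoc[symmetric])
    show "w * e = w"
      unfolding w_def sum_distrib_right by (intro sum.cong refl) (simp add: assms(1) mult.assoc)
    show "finite_rank z"
      unfolding z_def by (intro finite_rank_sum finite_rank_mult_left assms(4))
  qed
qed

section \<open>The trace as a sum over the spectrum, and the rank of idempotents\<close>

lemma finite_rank_riesz_idempotent:
  assumes "finite_rank x" "\<mu> \<noteq> 0"
  shows "finite_rank (riesz_idempotent x \<mu>)"
proof -
  obtain u where "riesz_idempotent x \<mu> = (x - 0 *\<^sub>C 1) * u"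
    using riesz_idempotent_in_range[OF algebraic_of_finite_rank[OF assms(1)], of 0 \<mu>] assms(2) by metis
  then show ?thesis
    using finite_rank_mult_right[OF assms(1)] by simp
qed

text \<open>On the range of the idempotent q, x is \<mu> plus a nilpotent element, and nilpotent
  elements of finite rank have trace 0.\<close>

lemma tr_mult_riesz_idempotent:
  assumes "finite_rank x"
  shows "tr (x * riesz_idempotent x \<mu>) = \<mu> * tr (riesz_idempotent x \<mu>)"
proof -
  define q where "q = riesz_idempotent x \<mu>"
  define N where "N = (x - \<mu> *\<^sub>C 1) * q"
  have alg: "algebraic_element x"
    by (rule algebraic_of_finite_rank[OF assms])
  have idem: "q * q = q"
    unfolding q_def by (rule riesz_idempotent_idem[OF alg])
  have comm: "q * (x - \<mu> *\<^sub>C 1) = (x - \<mu> *\<^sub>C 1) * q"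
    unfolding q_def by (rule riesz_idempotent_commute[OF alg])
      (simp add: algebra_simps scaleC_mult_simps)
  have pow: "N ^ n * q = (x - \<mu> *\<^sub>C 1) ^ n * q" for n
  proof (induction n)
    case (Suc n)
    have "N ^ Suc n * q = (x - \<mu> *\<^sub>C 1) * q * ((x - \<mu> *\<^sub>C 1) ^ n * q)"
      using Suc.IH by (simp add: N_def mult.assoc)
    also have "\<dots> = (x - \<mu> *\<^sub>C 1) * (q * (x - \<mu> *\<^sub>C 1) ^ n) * q"
      by (simp only: mult.assoc)
    also have "q * (x - \<mu> *\<^sub>C 1) ^ n = (x - \<mu> *\<^sub>C 1) ^ n * q"
      by (induction n) (simp_all add: mult.assoc[symmetric] comm, simp add: mult.assoc)
    finally show ?case
      by (simp add: mult.assoc idem)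
  qed simp
  obtain n where "(x - \<mu> *\<^sub>C 1) ^ n * q = 0"
    unfolding q_def by (rule riesz_idempotent_nilpotent[OF alg])
  then have "N ^ n * N = 0"
    using pow[of n] comm unfolding N_def by (metis mult.assoc mult_zero_left)
  then have nil: "N ^ Suc n = 0"
    by (simp add: power_commutes)
  have xq: "x * q = N + \<mu> *\<^sub>C q"
    by (simp add: N_def left_diff_distrib scaleC_mult_simps)
  show ?thesis
  \<comment> \<open>At 0 the idempotent need not have finite rank, so linearity cannot be applied to
    \<mu> q; but there x q is itself the nilpotent part.\<close>
  proof (cases "\<mu> = 0")
    case True
    then have "finite_rank N"
      using xq finite_rank_mult_right[OF assms, of q] by simp
    with True show ?thesis
      using tr_nilpotent[OF _ nil] xq by (simp add: q_def)
  next
    case False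
    have q: "finite_rank q"
      unfolding q_def by (rule finite_rank_riesz_idempotent[OF assms False])
    then have "finite_rank N"
      unfolding N_def by (rule finite_rank_mult_left)
    then show ?thesis
      unfolding q_def[symmetric] xq using q
      by (simp add: tr_add tr_scaleC finite_rank_scaleC tr_nilpotent[OF _ nil])
  qed
qed

lemma tr_eq_sum_spectrum:
  assumes "finite_rank x"
  shows "tr x = (\<Sum>\<mu>\<in>spectrum x. \<mu> * tr (riesz_idempotent x \<mu>))"
proof -
  have "tr x = tr (\<Sum>\<mu>\<in>spectrum x. x * riesz_idempotent x \<mu>)"
    unfolding sum_distrib_left[symmetric]
    by (simp add: sum_riesz_idempotents[OF algebraic_of_finite_rank[OF assms]])
  also have "\<dots> = (\<Sum>\<mu>\<in>spectrum x. tr (x * riesz_idempotent x \<mu>))"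
    by (intro tr_sum finite_rank_mult_right assms)
  finally show ?thesis
    by (simp add: tr_mult_riesz_idempotent[OF assms])
qed

text \<open>The sum \<open>g\<close> of the spectral idempotents of \<open>z e\<close> at nonzero points has trace at least the
  number of these points, and it is equivalent to an idempotent below \<open>e\<close>.\<close>

lemma card_spectrum_le_tr:
  assumes "e * e = e" "finite_rank e" "tr e = of_nat n"
  shows "card (spectrum (z * e) - {0}) \<le> n"
proof -
  define x where "x = z * e"
  define q where "q = riesz_idempotent x"
  define S where "S = spectrum x - {0}"
  have x: "finite_rank x"
    unfolding x_def by (rule finite_rank_mult_left[OF assms(2)])
  have alg: "algebraic_element x"
    by (rule algebraic_of_finite_rank[OF x])
  have fin: "finite S"
    unfolding S_def using finite_spectrum_algebraic[OF alg] by simp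
  have qS: "finite_rank (q \<mu>)" "\<exists>k>0. tr (q \<mu>) = of_nat k" "\<exists>u. q \<mu> = x * u" if "\<mu> \<in> S" for \<mu>
  proof -
    have \<mu>: "\<mu> \<noteq> 0" "\<mu> \<in> spectrum x"
      using that by (auto simp: S_def)
    show "finite_rank (q \<mu>)"
      unfolding q_def by (rule finite_rank_riesz_idempotent[OF x \<mu>(1)])
    then show "\<exists>k>0. tr (q \<mu>) = of_nat k"
      using tr_idempotent_nat[of "q \<mu>"] riesz_idempotent_idem[OF alg]
        riesz_idempotent_nonzero[OF alg \<mu>(2)] unfolding q_def by metis
    show "\<exists>u. q \<mu> = x * u"
      using riesz_idempotent_in_range[OF alg, of 0 \<mu>] \<mu>(1) unfolding q_def
      by (metis complex_vector.scale_zero_left diff_zero)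
  qed
  obtain k where k: "\<And>\<mu>. \<mu> \<in> S \<Longrightarrow> k \<mu> > 0 \<and> tr (q \<mu>) = of_nat (k \<mu>)"
    using qS(2) by metis
  obtain u where u: "\<And>\<mu>. \<mu> \<in> S \<Longrightarrow> q \<mu> = x * u \<mu>"
    using qS(3) by metis
  define g where "g = (\<Sum>\<mu>\<in>S. q \<mu>)"
  define w where "w = (\<Sum>\<mu>\<in>S. u \<mu>)"
  have gw: "g = z * e * w"
    unfolding g_def w_def x_def[symmetric] sum_distrib_left by (intro sum.cong refl u)
  have gg: "g * g = g"
  proof -
    have "g * g = (\<Sum>\<mu>\<in>S. \<Sum>\<nu>\<in>S. if \<mu> = \<nu> then q \<mu> else 0)"
      unfolding g_def sum_product q_def
      by (intro sum.cong refl) (simp add: riesz_idempotent_idem[OF alg] riesz_idempotents_orthogonal[OF alg])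
    also have "\<dots> = g"
      unfolding g_def using fin by (intro sum.cong refl) simp
    finally show ?thesis .
  qed
  have "tr g = of_nat (\<Sum>\<mu>\<in>S. k \<mu>)"
    unfolding g_def using tr_sum[of S q] qS(1) k by simp
  moreover have "card S \<le> (\<Sum>\<mu>\<in>S. k \<mu>)"
    using sum_mono[of S "\<lambda>_. 1" k] k by (force simp: Suc_le_eq)
  moreover have "(\<Sum>\<mu>\<in>S. k \<mu>) \<le> n" if "tr g = of_nat (\<Sum>\<mu>\<in>S. k \<mu>)"
  proof -
    \<comment> \<open>Since g = z e w is idempotent, g = (g z e)(e w g). Swapping the two factors
      gives h, an idempotent below e with the same trace.\<close>
    define h where "h = e * w * (g * z * e)"
    have "h * h = e * w * (g * (z * (e * e) * w) * g * z * e)"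
      unfolding h_def by (simp only: mult.assoc)
    also have "\<dots> = e * w * (g * g * g * z * e)"
      unfolding assms(1) gw[symmetric] ..
    finally have hh: "h * h = h"
      unfolding gg h_def .
    have eh: "e * h = h" "h * e = h"
      unfolding h_def mult.assoc[symmetric] assms(1) by (simp_all add: mult.assoc assms(1))
    have h: "finite_rank h"
      unfolding h_def by (intro finite_rank_mult_left assms(2))
    have "tr h = tr (g * z * e * (e * w))"
      unfolding h_def by (intro tr_commute finite_rank_mult_right assms(2))
    also have "g * z * e * (e * w) = g * (z * (e * e) * w)"
      by (simp only: mult.assoc)
    finally have "tr h = tr g"
      unfolding assms(1) gw[symmetric] gg .
    \<comment> \<open>The complement of h in e also has a natural number as trace, which turns the
      equation of traces into an inequality.\<close>
    moreover have "(e - h) * (e - h) = e - h"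
      by (simp add: left_diff_distrib right_diff_distrib assms(1) eh hh)
    then obtain l :: nat where "tr (e - h) = of_nat l"
      using tr_idempotent_nat[OF _ finite_rank_diff[OF assms(2) h]] by metis
    ultimately have "of_nat n = (of_nat (l + (\<Sum>\<mu>\<in>S. k \<mu>)) :: complex)"
      using that tr_diff[OF assms(2) h] assms(3) by (simp add: algebra_simps)
    then show ?thesis
      unfolding of_nat_eq_iff by simp
  qed
  ultimately show ?thesis
    unfolding S_def x_def by simp
qed

lemma elem_rank_idempotent:
  assumes "e * e = e" "finite_rank e" "tr e = of_nat n"
  shows "elem_rank e = enat n"
proof -
  have fin: "finite (spectrum (z * e))" for z
    by (intro finite_spectrum_algebraic algebraic_of_finite_rank finite_rank_mult_left assms(2))
  then have rank: "elem_rank e = (SUP z. enat (card (spectrum (z * e) - {0})))"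
    unfolding elem_rank_def by (simp add: Let_def)
  obtain B v where B: "range_basis e B" and v: "dual_system B v"
    by (rule ex_range_dual[OF assms(2)])
  have n: "n = card B" and finB: "finite B"
    using tr_idempotent[OF assms(1) B] assms(3) B by (simp_all add: range_basis_def)
  have "card B = card {1..n}"
    by (simp add: n)
  then obtain \<iota> where \<iota>: "bij_betw \<iota> B {1..n}"
    using finite_same_card_bij[OF finB finite_atLeastAtMost] by blast
  \<comment> \<open>A diagonal operator on the range of e with the distinct nonzero eigenvalues 1,
    ..., n, so that the supremum in \<open>elem_rank\<close> reaches n.\<close>
  define z where "z = (\<Sum>b\<in>B. of_nat (\<iota> b) *\<^sub>C (b * v b))"
  have eig: "z * e * c = of_nat (\<iota> c) *\<^sub>C c" if c: "c \<in> B" for c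
  proof -
    have "z * e * c = z * c"
      using idempotent_range_basis(1)[OF assms(1) B c] by (simp add: mult.assoc)
    also have "\<dots> = (\<Sum>b\<in>B. if b = c then of_nat (\<iota> c) *\<^sub>C c else 0)"
      unfolding z_def sum_distrib_right
    proof (rule sum.cong[OF refl])
      fix b assume b: "b \<in> B"
      have "c * p = c"
        using c range_basis_subset_Ap[OF B] by (auto simp: in_Ap_iff)
      then show "of_nat (\<iota> b) *\<^sub>C (b * v b) * c = (if b = c then of_nat (\<iota> c) *\<^sub>C c else 0)"
        using b c v by (simp add: dual_system_def scaleC_mult_simps mult.assoc)
    qed
    finally show ?thesis
      using finB c by simp
  qed
  have "of_nat ` {1..n} \<subseteq> spectrum (z * e) - {0}"
  proof clarify
    fix i assume i: "i \<in> {1..n}"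
    then obtain c where c: "c \<in> B" "\<iota> c = i"
      using \<iota> by (metis bij_betw_imp_surj_on imageE)
    have "c \<noteq> 0"
      using B c(1) complex_vector.dependent_zero unfolding range_basis_def by blast
    have "of_nat i \<in> spectrum (z * e)"
      unfolding spectrum_def is_inverse_def
    proof clarify
      fix y assume "y * (of_nat i *\<^sub>C 1 - z * e) = 1"
      then have "c = y * ((of_nat i *\<^sub>C 1 - z * e) * c)"
        by (simp add: mult.assoc[symmetric])
      also have "(of_nat i *\<^sub>C 1 - z * e) * c = 0"
        using eig[OF c(1)] c(2) by (simp add: left_diff_distrib scaleC_mult_simps)
      finally show False
        using \<open>c \<noteq> 0\<close> by simp
    qed
    then show "of_nat i \<in> spectrum (z * e) - {0}"
      using i by simp
  qed
  then have "card (of_nat ` {1..n} :: complex set) \<le> card (spectrum (z * e) - {0})"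
    using fin by (intro card_mono) auto
  moreover have "card (of_nat ` {1..n} :: complex set) = n"
    by (subst card_image) (simp_all add: inj_on_def)
  ultimately have "enat n \<le> elem_rank e"
    unfolding rank by (intro SUP_upper2[of z]) auto
  moreover have "elem_rank e \<le> enat n"
    unfolding rank by (intro SUP_least) (simp add: card_spectrum_le_tr[OF assms])
  ultimately show ?thesis
    by (rule antisym[rotated])
qed

lemma soc_trace_eq_tr:
  assumes "finite_rank x"
  shows "soc_trace x = tr x"
  unfolding soc_trace_def tr_eq_sum_spectrum[OF assms]
proof (rule sum.cong[OF refl])
  fix \<mu>
  show "of_nat (alg_mult \<mu> x) * \<mu> = \<mu> * tr (riesz_idempotent x \<mu>)"
  proof (cases "\<mu> = 0")
    case False
    note q = riesz_idempotent_idem[OF algebraic_of_finite_rank[OF assms], of \<mu>]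
      finite_rank_riesz_idempotent[OF assms False]
    obtain n where n: "tr (riesz_idempotent x \<mu>) = of_nat n"
      using tr_idempotent_nat[OF q] by metis
    then show ?thesis
      by (simp add: alg_mult_def elem_rank_idempotent[OF q n])
  qed simp
qed


section \<open>Fredholm elements of index zero\<close>

text \<open>Equality of cosets in A/J once J is known to consist of the finite rank elements; the
  computations can so be carried out in A.\<close>

definition fr_cong :: "'a \<Rightarrow> 'a \<Rightarrow> bool"  (infix \<open>\<sim>\<^sub>J\<close> 50)
  where "x \<sim>\<^sub>J y \<longleftrightarrow> finite_rank (x - y)"

lemma fr_cong_refl [simp]: "x \<sim>\<^sub>J x"
  by (simp add: fr_cong_def finite_rank_0)

lemma fr_cong_sym: "x \<sim>\<^sub>J y \<Longrightarrow> y \<sim>\<^sub>J x"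
  unfolding fr_cong_def using finite_rank_uminus by fastforce

lemma fr_cong_trans [trans]: "x \<sim>\<^sub>J y \<Longrightarrow> y \<sim>\<^sub>J z \<Longrightarrow> x \<sim>\<^sub>J z"
  unfolding fr_cong_def using finite_rank_add by fastforce

lemma fr_cong_diff: "x \<sim>\<^sub>J y \<Longrightarrow> x' \<sim>\<^sub>J y' \<Longrightarrow> x - x' \<sim>\<^sub>J y - y'"
  unfolding fr_cong_def using finite_rank_diff[of "x - y" "x' - y'"] by (simp add: algebra_simps)

lemma fr_cong_add: "x \<sim>\<^sub>J y \<Longrightarrow> x' \<sim>\<^sub>J y' \<Longrightarrow> x + x' \<sim>\<^sub>J y + y'"
  unfolding fr_cong_def using finite_rank_add[of "x - y" "x' - y'"] by (simp add: algebra_simps)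

lemma fr_cong_left: "x \<sim>\<^sub>J y \<Longrightarrow> a * x \<sim>\<^sub>J a * y"
  unfolding fr_cong_def using finite_rank_mult_left by (metis right_diff_distrib)

lemma fr_cong_right: "x \<sim>\<^sub>J y \<Longrightarrow> x * a \<sim>\<^sub>J y * a"
  unfolding fr_cong_def using finite_rank_mult_right by (metis left_diff_distrib)

lemma fr_cong_0: "x \<sim>\<^sub>J 0 \<longleftrightarrow> finite_rank x"
  by (simp add: fr_cong_def)

text \<open>The change j of one factor has finite rank, and j z - z j has trace 0. This makes the
  index independent of representatives modulo J.\<close>

lemma tr_commutator_cong:
  assumes "x \<sim>\<^sub>J y" "y * z \<sim>\<^sub>J z * y"
  shows "x * z \<sim>\<^sub>J z * x" "tr (x * z - z * x) = tr (y * z - z * y)"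
proof -
  define j where "j = x - y"
  have j: "finite_rank j"
    using assms(1) by (simp add: j_def fr_cong_def)
  then have jz: "finite_rank (j * z)" "finite_rank (z * j)"
    by (rule finite_rank_mult_right, rule finite_rank_mult_left)
  have yz: "finite_rank (y * z - z * y)"
    using assms(2) by (simp add: fr_cong_def)
  have eq: "x * z - z * x = (y * z - z * y) + (j * z - z * j)"
    by (simp add: j_def algebra_simps)
  show "x * z \<sim>\<^sub>J z * x"
    unfolding fr_cong_def eq by (intro finite_rank_add finite_rank_diff yz jz)
  show "tr (x * z - z * x) = tr (y * z - z * y)"
    unfolding eq using tr_add[OF yz finite_rank_diff[OF jz]] tr_diff[OF jz] tr_commute[OF j, of z]
    by simp
qed

section \<open>Inverses modulo the socle in a corner\<close>

lemma regular_lift: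
  assumes corner: "P * P = P" "P * U = U" "U * P = U" "P * V = V" "V * P = V"
    and UV: "U * V \<sim>\<^sub>J P" and VU: "V * U \<sim>\<^sub>J P"
  obtains W where "P * W = W" "W * P = W" "W \<sim>\<^sub>J V" "U * W * U = U" "W * U * W = W"
proof -
  define f where "f = P - V * U"
  have f: "finite_rank f"
    using fr_cong_sym[OF VU] by (simp add: f_def fr_cong_def)
  have Uf: "U * f = U - U * V * U"
    by (simp add: f_def right_diff_distrib corner mult.assoc)
  obtain s where s: "U * f * s * (U * f) = U * f"
    using finite_rank_regular[OF finite_rank_mult_left[OF f]] by metis
  \<comment> \<open>The defect of V is U - U V U = U f, of finite rank. Multiplied by U on both
    sides, the correction term becomes U f s U f = U f, which is exactly this defect.\<close>
  define W0 where "W0 = V + f * s * (P - U * V)"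
  have Pf: "P * f = f"
    by (simp add: f_def right_diff_distrib corner mult.assoc[symmetric])
  have PW0: "P * W0 = W0" "W0 * P = W0"
    unfolding W0_def distrib_left distrib_right mult.assoc[symmetric] corner Pf
    by (simp_all add: mult.assoc left_diff_distrib corner)
  have "U * W0 * U = U * V * U + U * f * s * (P * U - U * V * U)"
    by (simp add: W0_def distrib_left distrib_right left_diff_distrib right_diff_distrib mult.assoc)
  also have "\<dots> = U"
    unfolding corner Uf[symmetric] s by (simp add: Uf)
  finally have UWU: "U * W0 * U = U" .
  have W0V: "W0 \<sim>\<^sub>J V"
    using f by (simp add: fr_cong_def W0_def mult.assoc finite_rank_mult_right)
  \<comment> \<open>So far W0 is only an inner inverse; W0 U W0 satisfies the second identity as
    well and stays in the class of V.\<close>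
  have "W0 * U * W0 \<sim>\<^sub>J V * U * V"
    using fr_cong_trans[OF fr_cong_right[OF fr_cong_right[OF W0V]] fr_cong_left[OF W0V]] .
  also have "V * U * V \<sim>\<^sub>J P * V"
    by (rule fr_cong_right[OF VU])
  finally have "W0 * U * W0 \<sim>\<^sub>J V"
    by (simp add: corner)
  moreover have "P * (W0 * U * W0) = W0 * U * W0" "W0 * U * W0 * P = W0 * U * W0"
    by (simp_all add: mult.assoc PW0) (simp add: mult.assoc[symmetric] PW0)
  moreover have "U * (W0 * U * W0) * U = U"
    by (metis UWU mult.assoc)
  moreover have "W0 * U * W0 * U * (W0 * U * W0) = W0 * U * W0"
    by (metis UWU mult.assoc)
  ultimately show thesis
    by (intro that[of "W0 * U * W0"])
qed

text \<open>A Fredholm element \<open>U\<close> of index zero in a corner \<open>P A P\<close> is a finite rank perturbation of an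
  invertible one: the idempotents \<open>P - U W\<close> and \<open>P - W U\<close> (projections to the cokernel and the kernel
  of \<open>U\<close>) have the same rank, and an equivalence between them repairs \<open>U\<close>.\<close>

lemma index_zero_invertible:
  assumes corner: "P * P = P" "P * U = U" "U * P = U" "P * V = V" "V * P = V"
    and UV: "U * V \<sim>\<^sub>J P" and VU: "V * U \<sim>\<^sub>J P" and tr0: "tr (U * V - V * U) = 0"
  obtains U' V' where "P * U' = U'" "U' * P = U'" "P * V' = V'" "V' * P = V'"
    "U' * V' = P" "V' * U' = P" "U' \<sim>\<^sub>J U"
proof -
  obtain W where W: "P * W = W" "W * P = W" "W \<sim>\<^sub>J V" "U * W * U = U" "W * U * W = W"
    by (rule regular_lift[OF corner UV VU])
  define e where "e = P - U * W"
  define f where "f = P - W * U"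
  have "V * U \<sim>\<^sub>J U * V"
    using VU fr_cong_sym[OF UV] by (rule fr_cong_trans)
  then have trW: "tr (W * U - U * W) = tr (V * U - U * V)"
    by (rule tr_commutator_cong(2)[OF W(3)])
  have "finite_rank (U * V - V * U)"
    using UV fr_cong_sym[OF VU] unfolding fr_cong_def[symmetric] by (rule fr_cong_trans)
  then have "tr (W * U - U * W) = 0"
    using trW tr0 tr_scaleC[of "U * V - V * U" "- 1"] by (simp add: scaleC_one)
  moreover have e: "finite_rank e"
    using fr_cong_trans[OF fr_cong_left[OF W(3)] UV] fr_cong_sym unfolding e_def fr_cong_def by blast
  moreover have f: "finite_rank f"
    using fr_cong_trans[OF fr_cong_right[OF W(3)] VU] fr_cong_sym unfolding f_def fr_cong_def by blast
  moreover have "e - f = W * U - U * W"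
    by (simp add: e_def f_def)
  ultimately have tr_eq: "tr e = tr f"
    using tr_diff[OF e f] by simp
  have PUW: "P * (U * W) = U * W" "U * W * P = U * W" "U * W * (U * W) = U * W"
    and PWU: "P * (W * U) = W * U" "W * U * P = W * U" "W * U * (W * U) = W * U"
    using corner W by (metis mult.assoc)+
  have ee: "e * e = e" and ff: "f * f = f"
    unfolding e_def f_def by (simp_all add: left_diff_distrib right_diff_distrib corner PUW PWU)
  have Pe: "P * e = e" "e * P = e" and Pf: "P * f = f" "f * P = f"
    unfolding e_def f_def by (simp_all add: left_diff_distrib right_diff_distrib corner PUW PWU)
  have eU: "e * U = 0" and Uf: "U * f = 0" and fW: "f * W = 0" and We: "W * e = 0"
    unfolding e_def f_def
    by (simp_all add: left_diff_distrib right_diff_distrib corner W mult.assoc[symmetric])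
  obtain z w where zw: "z * w = e" "w * z = f" "e * z = z" "z * f = z" "f * w = w" "w * e = w"
    and z: "finite_rank z"
    by (rule equivalent_idempotents[OF ee e ff f tr_eq])
  \<comment> \<open>Here z maps the kernel of U in the corner onto a complement of its range, and w
    is the reverse map. All mixed products vanish, which leaves U W + z w = P and W U + w z =
    P.\<close>
  have "U * w = 0" "z * W = 0" "W * z = 0" "w * U = 0"
    using zw eU Uf fW We by (metis mult.assoc mult_zero_left mult_zero_right)+
  then have "(U + z) * (W + w) = P" "(W + w) * (U + z) = P"
    by (simp_all add: distrib_left distrib_right zw) (simp_all add: e_def f_def)
  moreover have "P * (U + z) = U + z" "(U + z) * P = U + z" "P * (W + w) = W + w" "(W + w) * P = W + w"
    unfolding distrib_left distrib_right corner W using zw Pe Pf by (metis mult.assoc)+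
  moreover have "U + z \<sim>\<^sub>J U"
    by (simp add: fr_cong_def z)
  ultimately show thesis
    by (intro that[of "U + z" "W + w"])
qed

section \<open>Assembling a Drazin invertible element from two corners\<close>

lemma peirce_sum_drazin_inverse:
  fixes P U V Q D :: 'a
  assumes "P * P = P" "P * U = U" "U * P = U" "P * V = V" "V * P = V" "U * V = P" "V * U = P"
    and PQ: "P * Q = 0" "Q * P = 0"
    and D: "D * Q * D = D" "Q * D = D * Q" "Q ^ k * (1 - D * Q) = 0"
  shows "drazin_inverse ring_of_type_algebra (U + Q) (V + D)"
proof -
  \<comment> \<open>Written with Q at either end, D is seen to lie in the corner of 1 - P like Q, so
    products across the corners vanish.\<close>
  have "D = Q * D * D" "D = D * D * Q"
    using D(1,2) by (metis mult.assoc)+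
  then have PD: "P * D = 0" "D * P = 0"
    using PQ by (metis mult.assoc mult_zero_left mult_zero_right)+
  have cross: "U * D = 0" "Q * V = 0" "V * Q = 0" "D * U = 0" "U * Q = 0" "Q * U = 0"
    using assms(2-5) PQ PD by (metis mult.assoc mult_zero_left mult_zero_right)+
  have dy: "(V + D) * (U + Q) = P + D * Q" and yd: "(U + Q) * (V + D) = P + D * Q"
    using D(2) by (simp_all add: distrib_left distrib_right assms(6,7) cross)
  \<comment> \<open>The idempotent on which U + Q must be nilpotent; U vanishes on it, so powers of
    U + Q act there as powers of Q.\<close>
  define r where "r = 1 - (P + D * Q)"
  have Qr: "Q * r = r * Q" and br: "(U + Q) * r = Q * r"
    unfolding r_def using D(2)
    by (simp_all add: left_diff_distrib right_diff_distrib distrib_left distrib_right PQ assms(3)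
      mult.assoc[symmetric] cross)
  have pow: "(U + Q) ^ n * r = Q ^ n * r" for n
  proof (induction n)
    case (Suc n)
    have "(U + Q) ^ Suc n * r = (U + Q) ^ n * r * Q"
      by (simp only: power_Suc2 mult.assoc br Qr)
    also have "\<dots> = Q ^ Suc n * r"
      by (simp only: Suc.IH power_Suc2 mult.assoc Qr)
    finally show ?case .
  qed simp
  \<comment> \<open>The extra factor Q in \<open>Suc k\<close> kills the summand P of 1 - r.\<close>
  have "Q ^ Suc k * r = Q ^ Suc k * (1 - D * Q) - Q ^ k * (Q * P)"
    by (simp add: r_def power_Suc2 algebra_simps del: power_Suc)
  also have "Q ^ Suc k * (1 - D * Q) = Q * (Q ^ k * (1 - D * Q))"
    by (simp add: mult.assoc)
  finally have "(U + Q) ^ Suc k * r = 0"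
    unfolding pow by (simp add: D(3) PQ)
  then have "(U + Q) ^ Suc k * (P + D * Q) = (U + Q) ^ Suc k"
    unfolding r_def right_diff_distrib by simp
  then have "(U + Q) ^ Suc k * (V + D) * (U + Q) = (U + Q) ^ Suc k"
    unfolding mult.assoc dy .
  moreover have "(V + D) * (U + Q) * (V + D) = V + D"
    unfolding dy by (simp add: distrib_left distrib_right assms(4) PD D(1))
      (simp add: mult.assoc cross)
  ultimately show ?thesis
    unfolding drazin_inverse_ring_of_type_algebra using dy yd by metis
qed

lemma index_zero_decomposition:
  assumes "a0 * a * a0 \<sim>\<^sub>J a0" "a * a0 \<sim>\<^sub>J a0 * a" "a ^ k * a0 * a \<sim>\<^sub>J a ^ k"
    and "tr (a * a0 - a0 * a) = 0"
  obtains b where "drazin_invertible ring_of_type_algebra b" "a \<sim>\<^sub>J b"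
proof -
  define E where "E = a * a0"
  have EE: "E * E \<sim>\<^sub>J E"
    using fr_cong_left[OF assms(1), of a] by (simp add: E_def mult.assoc)
  \<comment> \<open>The polynomial X^2 - X: idempotency modulo J makes E algebraic.\<close>
  have "peval [:0, - 1, 1:] E = E * E - E"
    by (simp add: scaleC_one algebra_simps)
  then have alg: "algebraic_element E"
    using EE by (intro algebraic_of_finite_rank_peval[of "[:0, - 1, 1:]"]) (simp_all add: fr_cong_def)
  define P where "P = riesz_idempotent E 1"
  have PP: "P * P = P"
    unfolding P_def by (rule riesz_idempotent_idem[OF alg])
  \<comment> \<open>Since P is a multiple of E, E P is congruent to P; since 1 - P is a multiple of
    E - 1, E P is congruent to E.\<close>
  have PE: "P \<sim>\<^sub>J E"
  proof -
    obtain u where "P = (E - 0 *\<^sub>C 1) * u"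
      using riesz_idempotent_in_range[OF alg, of 0 1] unfolding P_def by auto
    then have "E * P \<sim>\<^sub>J P"
      using fr_cong_right[OF EE, of u] by (simp add: mult.assoc)
    moreover have "E * P \<sim>\<^sub>J E"
    proof -
      obtain h where "1 - P = (E - 1 *\<^sub>C 1) * h"
        using one_minus_riesz_idempotent[OF alg, of 1] unfolding P_def by metis
      then have h: "1 - P = (E - 1) * h"
        by (simp add: scaleC_one)
      have "E - E * P = (E * E - E) * h"
        using arg_cong[OF h, of "(*) E"] by (simp add: algebra_simps)
      then have "E \<sim>\<^sub>J E * P"
        using EE finite_rank_mult_right by (simp add: fr_cong_def)
      then show ?thesis
        by (rule fr_cong_sym)
    qed
    ultimately show ?thesis
      using fr_cong_sym fr_cong_trans by blast
  qed
  have P1: "P \<sim>\<^sub>J a * a0" and P2: "P \<sim>\<^sub>J a0 * a"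
    using PE fr_cong_trans[OF PE] assms(2) unfolding E_def by blast+
  have aP: "a * P \<sim>\<^sub>J P * a"
  proof -
    have "a * P \<sim>\<^sub>J a * a0 * a"
      using fr_cong_left[OF P2, of a] by (simp add: mult.assoc)
    also have "a * a0 * a \<sim>\<^sub>J P * a"
      by (rule fr_cong_sym[OF fr_cong_right[OF P1]])
    finally show ?thesis .
  qed
  have Pa0: "P * a0 \<sim>\<^sub>J a0" and a0P: "a0 * P \<sim>\<^sub>J a0"
    using fr_cong_trans[OF fr_cong_right[OF P2, of a0] assms(1)]
      fr_cong_trans[OF fr_cong_left[OF P1, of a0]] assms(1) by (simp_all add: mult.assoc)
  define U where "U = P * a * P"
  define V where "V = P * a0 * P"
  define Q where "Q = (1 - P) * a * (1 - P)"
  have corner: "P * U = U" "U * P = U" "P * V = V" "V * P = V" "P * Q = 0" "Q * P = 0"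
    unfolding U_def V_def Q_def
    by (simp_all add: mult.assoc PP left_diff_distrib right_diff_distrib)
      (simp_all add: mult.assoc[symmetric] PP)
  have V: "V \<sim>\<^sub>J a0"
    unfolding V_def using fr_cong_right[OF Pa0, of P] a0P by (rule fr_cong_trans)
  have UaP: "U \<sim>\<^sub>J a * P"
    using fr_cong_right[OF fr_cong_sym[OF aP], of P] unfolding U_def by (simp add: mult.assoc PP)
  have a: "a \<sim>\<^sub>J U + Q"
  proof -
    \<comment> \<open>The two off-diagonal blocks of a, in J because a commutes with P modulo
      J.\<close>
    have "a - (U + Q) = (a * P - U) + (P * a - U)"
      by (simp add: U_def Q_def algebra_simps)
    moreover have "a * P - U \<sim>\<^sub>J a * P - a * P" "P * a - U \<sim>\<^sub>J P * a - P * a"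
      using UaP fr_cong_trans[OF UaP aP] by (intro fr_cong_diff; simp)+
    ultimately show ?thesis
      unfolding fr_cong_def[of a] using finite_rank_add[of "a * P - U" "P * a - U"]
      by (metis diff_self fr_cong_0)
  qed
  have UV: "U * V \<sim>\<^sub>J P"
  proof -
    have "U * V \<sim>\<^sub>J P * a * P * a0"
      using fr_cong_left[OF V, of U] by (simp add: U_def)
    also have "P * a * P * a0 \<sim>\<^sub>J P * (a * a0)"
      using fr_cong_left[OF Pa0, of "P * a"] by (simp add: mult.assoc)
    also have "P * (a * a0) \<sim>\<^sub>J P * P"
      by (rule fr_cong_left[OF fr_cong_sym[OF P1]])
    finally show ?thesis
      by (simp add: PP)
  qed
  have VU: "V * U \<sim>\<^sub>J P"
  proof -
    have "V * U \<sim>\<^sub>J a0 * P * a * P"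
      using fr_cong_right[OF V, of U] by (simp add: U_def mult.assoc)
    also have "a0 * P * a * P \<sim>\<^sub>J a0 * a * P"
      using fr_cong_right[OF a0P, of "a * P"] by (simp add: mult.assoc)
    also have "a0 * a * P \<sim>\<^sub>J P * P"
      by (rule fr_cong_right[OF fr_cong_sym[OF P2]])
    finally show ?thesis
      by (simp add: PP)
  qed
  \<comment> \<open>First a0 is replaced by V, then a by U + Q; finally Q drops out because it
    annihilates V on both sides.\<close>
  have tr0: "tr (U * V - V * U) = 0"
  proof -
    have "finite_rank (a * a0 - a0 * a)"
      using assms(2) by (simp add: fr_cong_def)
    then have 0: "tr (a0 * a - a * a0) = 0"
      using assms(4) tr_scaleC[of "a * a0 - a0 * a" "- 1"] by (simp add: scaleC_one)
    note Va = tr_commutator_cong[OF V fr_cong_sym[OF assms(2)]]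
    have "finite_rank (V * a - a * V)"
      using Va(1) by (simp add: fr_cong_def)
    then have "tr (a * V - V * a) = 0"
      using Va(2) 0 tr_scaleC[of "V * a - a * V" "- 1"] by (simp add: scaleC_one)
    moreover have "tr ((U + Q) * V - V * (U + Q)) = tr (a * V - V * a)"
      by (rule tr_commutator_cong(2)[OF fr_cong_sym[OF a] fr_cong_sym[OF Va(1)]])
    moreover have "Q * V = 0" "V * Q = 0"
      using corner by (metis mult.assoc mult_zero_left mult_zero_right)+
    ultimately show ?thesis
      by (simp add: distrib_left distrib_right)
  qed
  obtain U' V' where U': "P * U' = U'" "U' * P = U'" "P * V' = V'" "V' * P = V'"
    "U' * V' = P" "V' * U' = P" "U' \<sim>\<^sub>J U"
    by (rule index_zero_invertible[OF PP corner(1-4) UV VU tr0])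
  \<comment> \<open>The powers start at 1, since Q^0 = 1 does not match 1 - P.\<close>
  have "Q ^ Suc n \<sim>\<^sub>J a ^ Suc n * (1 - P)" for n
  proof -
    have comm: "(1 - P) * a \<sim>\<^sub>J a * (1 - P)"
      unfolding left_diff_distrib right_diff_distrib using fr_cong_sym[OF aP]
      by (intro fr_cong_diff) simp_all
    have Q: "Q \<sim>\<^sub>J a * (1 - P)"
      using fr_cong_right[OF comm, of "1 - P"] unfolding Q_def
      by (simp add: algebra_simps PP)
    show ?thesis
    proof (induction n)
      case 0
      then show ?case
        using Q by simp
    next
      case (Suc n)
      have "Q ^ Suc (Suc n) \<sim>\<^sub>J a ^ Suc n * (1 - P) * Q"
        unfolding power_Suc2[of Q "Suc n"] by (rule fr_cong_right[OF Suc])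
      also have "a ^ Suc n * (1 - P) * Q = a ^ Suc n * Q"
        using corner(5) by (simp add: mult.assoc left_diff_distrib)
      also have "a ^ Suc n * Q \<sim>\<^sub>J a ^ Suc n * (a * (1 - P))"
        by (rule fr_cong_left[OF Q])
      finally show ?case
        unfolding power_Suc2[of a "Suc n"] mult.assoc .
    qed
  qed
  from this[of k] have "Q ^ Suc k \<sim>\<^sub>J 0"
  proof (rule fr_cong_trans)
    \<comment> \<open>Here P is congruent to a0 a, so the last Drazin identity for a0 shows that a^k
      (1 - P) lies in J.\<close>
    have "a ^ k * P \<sim>\<^sub>J a ^ k"
      using fr_cong_trans[OF fr_cong_left[OF P2, of "a ^ k"]] assms(3) by (simp add: mult.assoc)
    then have "a ^ k * (1 - P) \<sim>\<^sub>J a ^ k - a ^ k"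
      unfolding right_diff_distrib by (intro fr_cong_diff) simp_all
    then show "a ^ Suc k * (1 - P) \<sim>\<^sub>J 0"
      using fr_cong_left[of _ _ a] by (fastforce simp: mult.assoc)
  qed
  then have "finite_rank (peval ([:0, 1:] ^ Suc k) Q)"
    unfolding peval_power by (simp add: fr_cong_0 scaleC_one del: power_Suc)
  then have "algebraic_element Q"
    by (rule algebraic_of_finite_rank_peval[rotated]) simp
  then obtain D l where D: "D * Q * D = D" "Q * D = D * Q" "Q ^ l * (1 - D * Q) = 0"
    by (rule algebraic_element_drazin_inverse)
  show thesis
  proof (rule that)
    show "drazin_invertible ring_of_type_algebra (U' + Q)"
      using peirce_sum_drazin_inverse[OF PP U'(1-6) corner(5,6) D] unfolding drazin_invertible_def ..
    have "U + Q \<sim>\<^sub>J U' + Q"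
      by (intro fr_cong_add fr_cong_sym[OF U'(7)]) simp
    with a show "a \<sim>\<^sub>J U' + Q"
      by (rule fr_cong_trans)
  qed
qed

end


section \<open>The quotient by the socle\<close>

lemma ring_ring_of_type_algebra: "ring (ring_of_type_algebra :: 'a::ring_1 ring)"
proof -
  have "\<exists>y. x + y = 0" for x :: 'a
    using add.right_inverse by blast
  then show ?thesis
    unfolding ring_of_type_algebra_def using add.right_inverse
    by unfold_locales (auto simp: algebra_simps Units_def)
qed

lemma a_inv_ring_of_type_algebra: "\<ominus>\<^bsub>ring_of_type_algebra\<^esub> x = - (x :: 'a::ring_1)"
proof -
  interpret ring "ring_of_type_algebra :: 'a ring"
    by (rule ring_ring_of_type_algebra)
  show ?thesis
    by (rule minus_equality) (simp_all add: ring_of_type_algebra_def)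
qed

text \<open>Since y x = y^n x^n and x^n (z x) = x^n for large n, y x absorbs z x on the right;
  symmetrically z x absorbs y x on the left. Both thus equal y x z x, and y = y x y = z x y = z x z
  = z.\<close>

lemma (in ring) drazin_inverse_unique:
  assumes "drazin_inverse R x y" "drazin_inverse R x z"
  shows "y = z"
proof -
  have absorb: "y \<otimes> x = (y \<otimes> x) \<otimes> (z \<otimes> x)" "z \<otimes> x = (y \<otimes> x) \<otimes> (z \<otimes> x)"
    if y: "drazin_inverse R x y" and z: "drazin_inverse R x z" for y z
  proof -
    have [simp]: "x \<in> carrier R" "y \<in> carrier R" "z \<in> carrier R"
      and yx: "y \<otimes> x \<otimes> y = y" "x \<otimes> y = y \<otimes> x" and zx: "z \<otimes> x \<otimes> z = z" "x \<otimes> z = z \<otimes> x"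
      using y z by (auto simp: drazin_inverse_def)
    have pow: "(w \<otimes> x) [^] Suc n = w \<otimes> x" if "w \<otimes> x \<otimes> w = w" "w \<in> carrier R" for w and n :: nat
    proof (induction n)
      case (Suc n)
      then show ?case
        using that by (simp add: m_assoc[symmetric])
    qed (use that in simp)
    have e: "w \<otimes> x = w [^] Suc n \<otimes> x [^] Suc n" "w \<otimes> x = x [^] Suc n \<otimes> w [^] Suc n"
      if "w \<otimes> x \<otimes> w = w" "x \<otimes> w = w \<otimes> x" "w \<in> carrier R" for w and n :: nat
      using pow[OF that(1,3), of n] pow_mult_distrib[of w x "Suc n"] pow_mult_distrib[of x w "Suc n"] that
      by simp_all
    obtain k l :: nat where k: "x [^] k \<otimes> y \<otimes> x = x [^] k" and l: "x [^] l \<otimes> z \<otimes> x = x [^] l"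
      using y z by (auto simp: drazin_inverse_def)
    have up: "x [^] Suc n \<otimes> (w \<otimes> x) = x [^] Suc n" if "x [^] n \<otimes> w \<otimes> x = x [^] n" "x \<otimes> w = w \<otimes> x"
      "w \<in> carrier R" for w and n :: nat
    proof -
      have "x [^] Suc n \<otimes> (w \<otimes> x) = x [^] n \<otimes> (x \<otimes> w) \<otimes> x"
        using that(3) by (simp add: m_assoc)
      also have "\<dots> = x [^] n \<otimes> w \<otimes> x \<otimes> x"
        unfolding that(2) using that(3) by (simp add: m_assoc)
      finally show ?thesis
        by (simp add: that(1))
    qed
    have "y \<otimes> x = y [^] Suc l \<otimes> (x [^] Suc l \<otimes> (z \<otimes> x))"
      unfolding up[OF l zx(2) \<open>z \<in> carrier R\<close>] by (rule e(1)[OF yx \<open>y \<in> carrier R\<close>])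
    also have "\<dots> = (y \<otimes> x) \<otimes> (z \<otimes> x)"
      unfolding e(1)[OF yx \<open>y \<in> carrier R\<close>, of l] by (simp add: m_assoc del: nat_pow_Suc)
    finally show "y \<otimes> x = (y \<otimes> x) \<otimes> (z \<otimes> x)" .
    have comm: "x [^] Suc k \<otimes> (y \<otimes> x) = (y \<otimes> x) \<otimes> x [^] Suc k"
      by (rule group_commutes_pow) (simp_all add: m_assoc[symmetric] yx(2))
    have "z \<otimes> x = ((y \<otimes> x) \<otimes> x [^] Suc k) \<otimes> z [^] Suc k"
      unfolding comm[symmetric] up[OF k yx(2) \<open>y \<in> carrier R\<close>]
      by (rule e(2)[OF zx \<open>z \<in> carrier R\<close>])
    also have "\<dots> = (y \<otimes> x) \<otimes> (z \<otimes> x)"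
      unfolding e(2)[OF zx \<open>z \<in> carrier R\<close>, of k] by (simp add: m_assoc del: nat_pow_Suc)
    finally show "z \<otimes> x = (y \<otimes> x) \<otimes> (z \<otimes> x)" .
  qed
  have [simp]: "x \<in> carrier R" "y \<in> carrier R" "z \<in> carrier R"
    using assms by (auto simp: drazin_inverse_def)
  have eq: "y \<otimes> x = z \<otimes> x"
    using absorb[OF assms] by simp
  have "y = y \<otimes> x \<otimes> y"
    using assms(1) by (simp add: drazin_inverse_def)
  also have "\<dots> = z \<otimes> (x \<otimes> y)"
    by (simp add: eq m_assoc)
  also have "x \<otimes> y = x \<otimes> z"
    using assms eq by (simp add: drazin_inverse_def)
  also have "z \<otimes> (x \<otimes> z) = z \<otimes> x \<otimes> z"
    by (simp add: m_assoc)
  also have "\<dots> = z"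
    using assms(2) unfolding drazin_inverse_def by blast
  finally show ?thesis .
qed

locale socle_is_finite_rank = prime_with_minimal_idempotent +
  assumes soc_eq: "soc = Collect finite_rank"
begin

text \<open>\<open>soc\<close> is defined from left ideals; closure under multiplication on the
  right comes from the description by finite rank.\<close>

lemma ideal_soc: "ideal soc (ring_of_type_algebra :: 'a ring)"
proof (rule idealI[OF ring_ring_of_type_algebra])
  interpret ring "ring_of_type_algebra :: 'a ring"
    by (rule ring_ring_of_type_algebra)
  show "subgroup soc (add_monoid (ring_of_type_algebra :: 'a ring))"
  proof (rule add.subgroupI)
    fix x :: 'a assume "x \<in> soc"
    then show "\<ominus>\<^bsub>ring_of_type_algebra\<^esub> x \<in> soc"
      unfolding a_inv_ring_of_type_algebra
      by (simp add: soc_eq finite_rank_uminus)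
  next
    have "0 \<in> (soc :: 'a set)"
      by (simp add: soc_eq finite_rank_0)
    then show "(soc :: 'a set) \<noteq> {}"
      by blast
  qed (auto simp: ring_of_type_algebra_def soc_eq finite_rank_add)
qed (simp_all add: ring_of_type_algebra_def soc_eq finite_rank_mult_left finite_rank_mult_right)

lemma quotient_map_hom: "quotient_map \<in> ring_hom ring_of_type_algebra (quotient_algebra :: 'a set ring)"
  using ideal.rcos_ring_hom[OF ideal_soc] unfolding quotient_map_def[abs_def] .

lemma ring_quotient: "ring (quotient_algebra :: 'a set ring)"
  by (rule ideal.quotient_is_ring[OF ideal_soc])

lemma quotient_map_carrier: "quotient_map x \<in> carrier (quotient_algebra :: 'a set ring)"
  using ring_hom_closed[OF quotient_map_hom, of x] by (simp add: ring_of_type_algebra_def)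

lemma quotient_map_surj:
  assumes "y \<in> carrier (quotient_algebra :: 'a set ring)"
  obtains x where "y = quotient_map x"
  using assms unfolding FactRing_def A_RCOSETS_def' quotient_map_def
  by (auto simp: ring_of_type_algebra_def)

lemma quotient_map_mult:
  "quotient_map (x * y) = quotient_map x \<otimes>\<^bsub>quotient_algebra\<^esub> quotient_map (y :: 'a)"
  using ring_hom_mult[OF quotient_map_hom, of x y] by (simp add: ring_of_type_algebra_def)

lemma quotient_map_power: "quotient_map (x ^ k) = quotient_map (x :: 'a) [^]\<^bsub>quotient_algebra\<^esub> (k :: nat)"
proof (induction k)
  case 0
  then show ?case
    using ring_hom_one[OF quotient_map_hom] by (simp add: ring_of_type_algebra_def)
next
  case (Suc k)
  then show ?case
    by (simp add: power_Suc2 quotient_map_mult del: power_Suc)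
qed

lemma quotient_map_eq_iff: "quotient_map x = quotient_map y \<longleftrightarrow> x \<sim>\<^sub>J y"
proof -
  interpret ring "ring_of_type_algebra :: 'a ring"
    by (rule ring_ring_of_type_algebra)
  have "x \<ominus>\<^bsub>ring_of_type_algebra\<^esub> y = x - y"
    unfolding a_minus_def a_inv_ring_of_type_algebra by (simp add: ring_of_type_algebra_def)
  then show ?thesis
    using quotient_eq_iff_same_a_r_cos[OF ideal_soc, of x y]
    by (simp add: ring_of_type_algebra_def quotient_map_def fr_cong_def soc_eq)
qed

section \<open>B-Fredholm elements and their index\<close>

lemma drazin_inverse_mod_soc_iff:
  "drazin_inverse_mod_soc a a0 \<longleftrightarrow>
    a0 * a * a0 \<sim>\<^sub>J a0 \<and> a * a0 \<sim>\<^sub>J a0 * a \<and> (\<exists>k. a ^ k * a0 * a \<sim>\<^sub>J a ^ k)"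
  unfolding drazin_inverse_mod_soc_def drazin_inverse_def quotient_map_eq_iff[symmetric]
  by (simp add: quotient_map_carrier quotient_map_mult quotient_map_power)

lemma B_Fredholm_iff: "B_Fredholm a \<longleftrightarrow> (\<exists>a0. drazin_inverse_mod_soc (a :: 'a) a0)"
  unfolding B_Fredholm_def drazin_invertible_def drazin_inverse_mod_soc_def
  using quotient_map_surj by (metis drazin_inverse_def)

text \<open>\<open>B_index\<close> uses an arbitrarily chosen a1. Drazin inverses in the quotient
  are unique, so a1 and a0 differ by an element of finite rank, which does not affect the trace of
  the commutator.\<close>

lemma B_index_eq:
  assumes "drazin_inverse_mod_soc a a0"
  shows "B_index a = tr (a * a0 - a0 * a)"
proof -
  define a1 where "a1 = (SOME a1. drazin_inverse_mod_soc a a1)"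
  have a1: "drazin_inverse_mod_soc a a1"
    unfolding a1_def using assms by (rule someI)
  have comm: "a * a0 \<sim>\<^sub>J a0 * a" "a * a1 \<sim>\<^sub>J a1 * a"
    using assms a1 by (simp_all add: drazin_inverse_mod_soc_iff)
  interpret ring "quotient_algebra :: 'a set ring"
    by (rule ring_quotient)
  have "a1 \<sim>\<^sub>J a0"
    unfolding quotient_map_eq_iff[symmetric]
    using drazin_inverse_unique assms a1 unfolding drazin_inverse_mod_soc_def by blast
  then have "tr (a1 * a - a * a1) = tr (a0 * a - a * a0)"
    by (rule tr_commutator_cong(2)[OF _ fr_cong_sym[OF comm(1)]])
  then have "tr (a * a1 - a1 * a) = tr (a * a0 - a0 * a)"
    using comm tr_scaleC[of "a * a1 - a1 * a" "- 1"] tr_scaleC[of "a * a0 - a0 * a" "- 1"]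
    by (simp add: fr_cong_def scaleC_one)
  moreover have "B_index a = tr (a * a1 - a1 * a)"
    unfolding B_index_def Let_def a1_def[symmetric]
    using comm(2) by (simp add: soc_trace_eq_tr fr_cong_def)
  ultimately show ?thesis
    by simp
qed

lemma B_Weyl_iff:
  "B_Weyl (a :: 'a) \<longleftrightarrow> (\<exists>b c. a = b + c \<and> drazin_invertible ring_of_type_algebra b \<and> c \<in> soc)"
proof
  assume "B_Weyl a"
  then obtain a0 where a0: "drazin_inverse_mod_soc a a0" and "B_index a = 0"
    unfolding B_Weyl_def B_Fredholm_iff by blast
  then have "tr (a * a0 - a0 * a) = 0"
    using B_index_eq by simp
  then obtain b where "drazin_invertible ring_of_type_algebra b" "a \<sim>\<^sub>J b"
    using a0 index_zero_decomposition unfolding drazin_inverse_mod_soc_iff by metis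
  then show "\<exists>b c. a = b + c \<and> drazin_invertible ring_of_type_algebra b \<and> c \<in> soc"
    by (intro exI[of _ b] exI[of _ "a - b"]) (simp add: soc_eq fr_cong_def)
next
  assume "\<exists>b c. a = b + c \<and> drazin_invertible ring_of_type_algebra b \<and> c \<in> soc"
  then obtain b c d where a: "a = b + c" and d: "drazin_inverse ring_of_type_algebra b d"
    and c: "finite_rank c"
    unfolding soc_eq drazin_invertible_def by blast
  have bd: "d * b * d = d" "b * d = d * b" "\<exists>k. b ^ k * d * b = b ^ k"
    using d unfolding drazin_inverse_ring_of_type_algebra by auto
  have ab: "a \<sim>\<^sub>J b"
    by (simp add: a fr_cong_def c)
  then have "quotient_map a = quotient_map b"
    by (simp add: quotient_map_eq_iff)
  moreover have "drazin_inverse_mod_soc b d"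
    unfolding drazin_inverse_mod_soc_iff using bd by (metis fr_cong_refl)
  ultimately have *: "drazin_inverse_mod_soc a d"
    unfolding drazin_inverse_mod_soc_def by simp
  \<comment> \<open>A Drazin inverse d of b in A is one of a modulo J, and it commutes with b
    exactly.\<close>
  have "tr (a * d - d * a) = tr (b * d - d * b)"
    by (rule tr_commutator_cong(2)[OF ab]) (simp add: bd(2))
  then have "B_index a = 0"
    unfolding B_index_eq[OF *] by (simp add: bd(2) tr_0)
  then show "B_Weyl a"
    unfolding B_Weyl_def B_Fredholm_iff using * by blast
qed

end

section \<open>Deriving the locale assumptions\<close>

lemma primitive_imp_prime:
  assumes "primitive_ideal ({0} :: 'a::complex_banach_algebra_1 set)" "\<And>z. (a :: 'a) * z * b = 0"
  shows "a = 0 \<or> b = 0"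
proof (rule disjCI)
  assume "b \<noteq> 0"
  obtain L where L: "maximal_left_ideal L" and L0: "{0} = {a :: 'a. \<forall>x. a * x \<in> L}"
    using assms(1) unfolding primitive_ideal_def by blast
  then obtain x where x: "b * x \<notin> L"
    using \<open>b \<noteq> 0\<close> by blast
  have left: "left_ideal L" and max: "\<And>M. left_ideal M \<Longrightarrow> L \<subseteq> M \<Longrightarrow> M = L \<or> M = UNIV"
    using L unfolding maximal_left_ideal_def by blast+
  have sub: "complex_vector.subspace L" and mult: "\<And>x y. y \<in> L \<Longrightarrow> x * y \<in> L"
    using left unfolding left_ideal_def by blast+
  \<comment> \<open>By maximality of L, the left ideal A b x + L is everything, so 1 = z b x + l.
    Multiplying by a c on the left removes the first term and puts a c into L for every c, which
    means a = 0.\<close>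
  define M where "M = {z * (b * x) + l | z l. l \<in> L}"
  have "left_ideal M"
    unfolding left_ideal_def complex_vector.subspace_def
  proof (intro conjI allI ballI)
    show "0 \<in> M"
      unfolding M_def using complex_vector.subspace_0[OF sub] by (intro CollectI exI[of _ 0]) simp
  next
    fix y y' assume "y \<in> M" "y' \<in> M"
    then obtain z l z' l' where "y = z * (b * x) + l" "l \<in> L" "y' = z' * (b * x) + l'" "l' \<in> L"
      unfolding M_def by blast
    then have "y + y' = (z + z') * (b * x) + (l + l')" "l + l' \<in> L"
      using complex_vector.subspace_add[OF sub] by (simp_all add: distrib_right)
    then show "y + y' \<in> M"
      unfolding M_def by blast
  next
    fix c y assume "y \<in> M"
    then obtain z l where "y = z * (b * x) + l" "l \<in> L"
      unfolding M_def by blast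
    then have "c *\<^sub>C y = (c *\<^sub>C z) * (b * x) + c *\<^sub>C l" "c *\<^sub>C l \<in> L"
      using complex_vector.subspace_scale[OF sub] by (simp_all add: scaleC_add_right scaleC_mult_simps)
    then show "c *\<^sub>C y \<in> M"
      unfolding M_def by blast
  next
    fix w y assume "y \<in> M"
    then obtain z l where "y = z * (b * x) + l" "l \<in> L"
      unfolding M_def by blast
    then have "w * y = (w * z) * (b * x) + w * l" "w * l \<in> L"
      using mult by (simp_all add: distrib_left mult.assoc)
    then show "w * y \<in> M"
      unfolding M_def by blast
  qed
  moreover have "L \<subseteq> M"
  proof
    fix l assume "l \<in> L"
    then have "0 * (b * x) + l \<in> M"
      unfolding M_def by blast
    then show "l \<in> M"
      by simp
  qed
  moreover have "M \<noteq> L"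
  proof -
    have "1 * (b * x) + 0 \<in> M"
      unfolding M_def using complex_vector.subspace_0[OF sub] by blast
    then show ?thesis
      using x by auto
  qed
  ultimately have "1 \<in> M"
    using max by blast
  then obtain z l where zl: "1 = z * (b * x) + l" "l \<in> L"
    unfolding M_def by blast
  have "a * c \<in> L" for c
  proof -
    have "a * c = a * c * (z * (b * x) + l)"
      unfolding zl(1)[symmetric] by simp
    also have "\<dots> = a * (c * z) * b * x + a * c * l"
      by (simp add: distrib_left mult.assoc)
    finally have "a * c = a * c * l"
      using assms(2)[of "c * z"] by simp
    moreover have "a * c * l \<in> L"
      by (rule mult[OF zl(2)])
    ultimately show ?thesis
      by metis
  qed
  then show "a = 0"
    using L0 by blast
qed

text \<open>The equality of operator ideals pulls back to A because the representation on Ap is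
  injective: a finite rank x has the same image as some element of the socle and therefore equals
  it.\<close>

lemma (in prime_with_minimal_idempotent) soc_eq_finite_rank:
  assumes "left_regular_rep p ` soc = finite_rank_operators Ap"
  shows "soc = Collect finite_rank"
proof (rule Set.set_eqI)
  fix x
  have fro: "left_regular_rep p x \<in> finite_rank_operators Ap \<longleftrightarrow>
      left_regular_rep p x \<in> carrier (bounded_operators Ap) \<and> finite_rank x" for x
    by (simp add: finite_rank_operators_def finite_rank_def left_regular_rep_def)
  have "finite_rank x" if "x \<in> soc"
  proof -
    have "left_regular_rep p x \<in> finite_rank_operators Ap"
      unfolding assms[symmetric] using that by (rule imageI)
    then show ?thesis
      unfolding fro by (rule conjunct2)
  qed
  moreover have "x \<in> soc" if x: "finite_rank x"
  proof -
    have "left_regular_rep p x \<in> carrier (bounded_operators Ap)"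
      unfolding bounded_operators_def left_regular_rep_def
      using complex_vector.subspace_add[OF subspace_Ap] complex_vector.subspace_scale[OF subspace_Ap]
      by (auto simp: mult_in_Ap distrib_left scaleC_mult_simps intro!: exI[of _ "norm x"] norm_mult_ineq)
    then have "left_regular_rep p x \<in> finite_rank_operators Ap"
      using x unfolding fro by (rule conjI)
    then obtain s where s: "s \<in> soc" "left_regular_rep p x = left_regular_rep p s"
      using assms by (metis imageE)
    have "x = s"
    proof (rule faithful)
      fix y assume "y \<in> Ap"
      then show "x * y = s * y"
        using fun_cong[OF s(2), of y] by (simp add: left_regular_rep_def)
    qed
    with s(1) show ?thesis
      by simp
  qed
  ultimately show "x \<in> soc \<longleftrightarrow> x \<in> Collect finite_rank"
    by blast
qed

theorem theorem3p4:
  fixes p a :: "'a::complex_banach_algebra_1"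
  assumes "primitive_ideal ({0} :: 'a set)"
    and "(soc :: 'a set) \<noteq> {0}"
    and "minimal_idempotent p"
    and "drazin_inverse_closed (range (left_regular_rep p))
           (bounded_operators (principal_left_ideal p))"
    and "left_regular_rep p ` soc = finite_rank_operators (principal_left_ideal p)"
  shows "B_Weyl a \<longleftrightarrow>
    (\<exists>b c. a = b + c \<and> drazin_invertible ring_of_type_algebra b \<and> c \<in> soc)"
proof -
  interpret prime_with_minimal_idempotent p
  proof
    show "x = 0 \<or> y = 0" if "\<And>z. x * z * y = 0" for x y :: 'a
      by (rule primitive_imp_prime[OF assms(1) that])
  qed (rule assms(3))
  interpret socle_is_finite_rank p
    using soc_eq_finite_rank[OF assms(5)] by unfold_locales
  show ?thesis
    by (rule B_Weyl_iff)
qed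

end
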